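(* Let $a,b>0$, let $\mathcal{E}$ be the ellipse $\frac{x^2}{a}+\frac{y^2}{b}=1$ in the Minkowski plane, let $\gamma\in\mathbb{R}\setminus\{-b,0,a\}$, and let $n$ be a positive integer. The billiard trajectories within $\mathcal{E}$ with non-degenerate caustic $\mathcal{C}_\gamma$ are $n$-periodic if and only if $nQ_0\sim nQ_\gamma$ (linear equivalence of divisors) on the elliptic curve $$\mathcal{K}:\quad y^2=\varepsilon(a-x)(b+x)(\gamma-x),\qquad \varepsilon=\operatorname{sign}\gamma,$$ where $Q_0$ is a point of $\mathcal{K}$ with $x=0$ and $Q_\gamma$ is the point of $\mathcal{K}$ with $x=\gamma$.
   Context: The Minkowski plane is $\mathbb{R}^2$ with the scalar product $\langle X,Y\rangle=X_1Y_1-X_2Y_2$; vectors $X,Y$ are orthogonal if $\langle X,Y\rangle=0$, and $v$ is space-like, time-like or light-like according to whether $\langle v,v\rangle>0$, $<0$ or $=0$. The family of conics confocal with $\mathcal{E}$ is $\mathcal{C}_\lambda:\ \frac{x^2}{a-\lambda}+\frac{y^2}{b+\lambda}=1$, $\lambda\in\mathbb{R}$; $\mathcal{C}_\lambda$ is an ellipse for $\lambda\in(-b,a)$ and a hyperbola for $\lambda<-b$ or $\lambda>a$. Billiard reflection: given a line $p$ that is not light-like and a vector $v$, write $v=u+w$ with $u$ parallel to $p$ and $w$ orthogonal to $p$ (in the Minkowski sense); the reflection of $v$ on $p$ is $u-w$. A billiard trajectory within $\mathcal{E}$ is a polygonal line with vertices on $\mathcal{E}$ such that the directions of consecutive segments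 are billiard reflections of each other with respect to the tangent line of $\mathcal{E}$ at the common vertex (the reflection is not defined where this tangent line is light-like). All lines containing segments of a given trajectory are tangent to the same conic $\mathcal{C}_\gamma$ of the confocal family, called the caustic of the trajectory; the caustic is non-degenerate when $\gamma\in\mathbb{R}\setminus\{-b,a\}$. A trajectory is $n$-periodic if it closes after $n$ reflections ($n$ is not required to be the minimal such number). The elliptic curve is understood as the smooth projective completion, with one point at infinity; the choice of which of the two points over $x=0$ is called $Q_0$ is immaterial. *)

theory Defs
  imports
    "HOL-Analysis.Analysis"
    "HOL-Computational_Algebra.Computational_Algebra"
    "HOL-Library.Poly_Mapping"
begin

section \<open>Billiards in the Minkowski plane\<close>

definition minkowski :: "real \<times> real \<Rightarrow> real \<times> real \<Rightarrow> real" where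
  "minkowski X Y = fst X * fst Y - snd X * snd Y"

definition light_like :: "real \<times> real \<Rightarrow> bool" where
  "light_like v \<longleftrightarrow> minkowski v v = 0"

definition central_conic :: "real \<Rightarrow> real \<Rightarrow> (real \<times> real) set" where
  "central_conic A B = {(x, y). x\<^sup>2 / A + y\<^sup>2 / B = 1}"

text \<open>
  The tangent line of \<open>x\<^sup>2 / A + y\<^sup>2 / B = 1\<close> at its projective point \<open>[x : y : z]\<close>;
  an affine point \<open>(x, y)\<close> of the conic is \<open>[x : y : 1]\<close>.
\<close>
definition conic_tangent :: "real \<Rightarrow> real \<Rightarrow> real \<Rightarrow> real \<Rightarrow> real \<Rightarrow> (real \<times> real) set" where
  "conic_tangent A B x y z = {(s, t). x * s / A + y * t / B = z}"

text \<open>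
  All tangent lines of the conic. Tangency is meant in the projective closure: the points at
  infinity (\<open>z = 0\<close>) of a hyperbola contribute its asymptotes. They have to be included, since a
  trajectory whose caustic is a hyperbola may contain a segment through the centre, and that
  segment then lies on an asymptote.
\<close>
definition tangent_lines :: "real \<Rightarrow> real \<Rightarrow> (real \<times> real) set set" where
  "tangent_lines A B =
     {conic_tangent A B x y z | x y z. (x, y, z) \<noteq> (0, 0, 0) \<and> x\<^sup>2 / A + y\<^sup>2 / B = z\<^sup>2}"

definition line_directions :: "(real \<times> real) set \<Rightarrow> (real \<times> real) set" where
  "line_directions p = {X - Y | X Y. X \<in> p \<and> Y \<in> p}"

text \<open>\<open>v'\<close> is the billiard reflection of \<open>v\<close> on the line \<open>p\<close>, which must not be light-like.\<close>
definition billiard_reflection ::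
    "(real \<times> real) set \<Rightarrow> real \<times> real \<Rightarrow> real \<times> real \<Rightarrow> bool" where
  "billiard_reflection p v v' \<longleftrightarrow>
     (\<forall>d \<in> line_directions p. d \<noteq> 0 \<longrightarrow> \<not> light_like d) \<and>
     (\<exists>u w. v = u + w \<and> u \<in> line_directions p \<and>
            (\<forall>d \<in> line_directions p. minkowski w d = 0) \<and> v' = u - w)"

text \<open>
  A trajectory is given by its successive vertices. The directions of consecutive segments are
  compared up to a positive factor, the segments having different lengths in general.
\<close>
definition billiard_trajectory :: "real \<Rightarrow> real \<Rightarrow> (nat \<Rightarrow> real \<times> real) \<Rightarrow> bool" where
  "billiard_trajectory a b P \<longleftrightarrow>
     (\<forall>i. P i \<in> central_conic a b) \<and>
     (\<forall>i. P i \<noteq> P (i + 1)) \<and>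
     (\<forall>i. \<exists>v' r. billiard_reflection
                     (conic_tangent a b (fst (P (i + 1))) (snd (P (i + 1))) 1)
                     (P (i + 1) - P i) v' \<and>
                 r > 0 \<and> P (i + 2) - P (i + 1) = r *\<^sub>R v')"

definition has_caustic :: "real \<Rightarrow> real \<Rightarrow> real \<Rightarrow> (nat \<Rightarrow> real \<times> real) \<Rightarrow> bool" where
  "has_caustic a b \<gamma> P \<longleftrightarrow>
     (\<forall>i. affine hull {P i, P (i + 1)} \<in> tangent_lines (a - \<gamma>) (b + \<gamma>))"

definition periodic_trajectory :: "nat \<Rightarrow> (nat \<Rightarrow> real \<times> real) \<Rightarrow> bool" where
  "periodic_trajectory n P \<longleftrightarrow> (\<forall>i. P (i + n) = P i)"

section \<open>Divisors on the curve \<open>y\<^sup>2 = f(x)\<close>\<close>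

text \<open>
  Here \<open>f\<close> is a complex cubic polynomial with simple roots, so that the projective closure of the
  affine curve is smooth and has a single point at infinity.
\<close>

datatype curve_point = Affine complex complex | Infinity

definition curve_points :: "complex poly \<Rightarrow> curve_point set" where
  "curve_points f = {Affine x y | x y. y\<^sup>2 = poly f x} \<union> {Infinity}"

definition poly_fls :: "complex poly \<Rightarrow> complex fls \<Rightarrow> complex fls" where
  "poly_fls p X = poly (map_poly fls_const p) X"

text \<open>
  \<open>(X, Y)\<close> is a formal parametrisation of the curve near a point, by a local parameter \<open>t\<close> at that
  point. The point at infinity is \<open>[0 : 1 : 0]\<close>, where \<open>x / y\<close> is a local parameter.
\<close>
fun local_parametrisation ::
    "complex poly \<Rightarrow> curve_point \<Rightarrow> complex fls \<times> complex fls \<Rightarrow> bool" where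
  "local_parametrisation f (Affine x y) (X, Y) \<longleftrightarrow>
     Y\<^sup>2 = poly_fls f X \<and>
     (\<exists>U V. X = fps_to_fls U \<and> Y = fps_to_fls V \<and>
            fps_nth U 0 = x \<and> fps_nth V 0 = y \<and> (fps_nth U 1 \<noteq> 0 \<or> fps_nth V 1 \<noteq> 0))"
| "local_parametrisation f Infinity (X, Y) \<longleftrightarrow>
     Y\<^sup>2 = poly_fls f X \<and> fls_subdegree X < 0 \<and> fls_subdegree (X / Y) = 1"

text \<open>
  The function field of the curve is \<open>\<complex>(x) \<oplus> \<complex>(x) y\<close>; a rational function is written as
  \<open>(p(x) + q(x) y) / r(x)\<close> with polynomials \<open>p\<close>, \<open>q\<close> and \<open>r \<noteq> 0\<close>. The order does not depend on the
  chosen parametrisation, because any two differ by an invertible substitution of \<open>t\<close>.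
\<close>
definition function_order ::
    "complex poly \<Rightarrow> curve_point \<Rightarrow> complex poly \<Rightarrow> complex poly \<Rightarrow> complex poly \<Rightarrow> int" where
  "function_order f P p q r =
     (let (X, Y) = (SOME XY. local_parametrisation f P XY)
      in fls_subdegree ((poly_fls p X + poly_fls q X * Y) / poly_fls r X))"

definition principal_divisor :: "complex poly \<Rightarrow> (curve_point \<Rightarrow>\<^sub>0 int) \<Rightarrow> bool" where
  "principal_divisor f D \<longleftrightarrow>
     Poly_Mapping.keys D \<subseteq> curve_points f \<and>
     (\<exists>p q r. (p \<noteq> 0 \<or> q \<noteq> 0) \<and> r \<noteq> 0 \<and>
        (\<forall>P \<in> curve_points f. Poly_Mapping.lookup D P = function_order f P p q r))"

definition linearly_equivalent ::
    "complex poly \<Rightarrow> (curve_point \<Rightarrow>\<^sub>0 int) \<Rightarrow> (curve_point \<Rightarrow>\<^sub>0 int) \<Rightarrow> bool" where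
  "linearly_equivalent f D D' \<longleftrightarrow> principal_divisor f (D - D')"

definition billiard_cubic :: "real \<Rightarrow> real \<Rightarrow> real \<Rightarrow> complex poly" where
  "billiard_cubic a b \<gamma> =
     smult (of_real (sgn \<gamma>)) ([:of_real a, -1:] * [:of_real b, 1:] * [:of_real \<gamma>, -1:])"

end

theory Submission
  imports Defs
begin

text \<open>
  A pair consisting of a point \<open>p\<close> of the ellipse and a tangent line of the caustic through \<open>p\<close> is
  encoded as a point of the curve \<open>y\<^sup>2 = f(x)\<close>: the tangent lines of the caustic are parametrised by
  \<open>x\<close> so that its four common tangents with the ellipse, which are the light-like ones, sit at
  \<open>a\<close>, \<open>-b\<close>, \<open>\<gamma>\<close> and \<open>\<infinity>\<close>, and \<open>\<plusminus> y\<close> distinguishes the two intersections of the line with the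
  ellipse. The two points of the curve with a common \<open>p\<close> are collinear with a fixed
  third point, through which the line \<open>Q\<^sub>0 Q\<^sub>\<gamma>\<close> passes too. Hence consecutive segments
  of a trajectory give points with \<open>S\<^sub>i - S\<^sub>i\<^sub>+\<^sub>1 \<sim> Q\<^sub>0 - Q\<^sub>\<gamma>\<close>, so that
  \<open>S\<^sub>i - S\<^sub>i\<^sub>+\<^sub>n \<sim> n Q\<^sub>0 - n Q\<^sub>\<gamma>\<close>; and distinct points of the curve are never linearly equivalent.
\<close>

section \<open>Divisors on a plane cubic\<close>

lemma poly_fls_0 [simp]: "poly_fls 0 X = 0"
  by (simp add: poly_fls_def)

lemma poly_fls_pCons [simp]: "poly_fls (pCons c p) X = fls_const c + X * poly_fls p X"
  by (simp add: poly_fls_def map_poly_pCons)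

lemma poly_fls_1 [simp]: "poly_fls 1 X = 1"
  by (simp add: one_pCons)

lemma poly_fls_add [simp]: "poly_fls (p + q) X = poly_fls p X + poly_fls q X"
  by (induction p q rule: poly_induct2) (simp_all add: algebra_simps flip: fls_plus_const)

lemma poly_fls_smult [simp]: "poly_fls (smult c p) X = fls_const c * poly_fls p X"
  by (induction p) (simp_all add: algebra_simps flip: fls_const_mult_const)

lemma poly_fls_minus [simp]: "poly_fls (- p) X = - poly_fls p X"
  by (induction p) simp_all

lemma poly_fls_diff [simp]: "poly_fls (p - q) X = poly_fls p X - poly_fls q X"
  using poly_fls_add[of p "- q"] by simp

lemma poly_fls_mult [simp]: "poly_fls (p * q) X = poly_fls p X * poly_fls q X"
  by (induction p) (simp_all add: algebra_simps)

lemma poly_fls_power [simp]: "poly_fls (p ^ n) X = poly_fls p X ^ n"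
  by (induction n) simp_all

lemma poly_fls_fps:
  obtains H where "poly_fls p (fps_to_fls U) = fps_to_fls H" "fps_nth H 0 = poly p (fps_nth U 0)"
proof -
  have "\<exists>H. poly_fls p (fps_to_fls U) = fps_to_fls H \<and> fps_nth H 0 = poly p (fps_nth U 0)"
  proof (induction p)
    case (pCons c p)
    then obtain H where "poly_fls p (fps_to_fls U) = fps_to_fls H" "fps_nth H 0 = poly p (fps_nth U 0)"
      by blast
    then show ?case
      by (intro exI[of _ "fps_const c + U * H"]) (simp add: fls_times_fps_to_fls)
  qed (auto intro: exI[of _ 0])
  then show thesis using that by blast
qed

text \<open>Over the complex numbers \<open>p\<close> splits into linear factors. None of them
  vanishes at a non-constant series, and Laurent series form a field.\<close>

lemma poly_fls_nonzero:
  assumes "\<And>c. X \<noteq> fls_const c" "p \<noteq> 0"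
  shows "poly_fls p X \<noteq> 0"
  using assms(2)
proof (induction p rule: poly_root_induct[where P = "\<lambda>_. True"])
  case (no_roots p)
  then have "constant (poly p)"
    using fundamental_theorem_of_algebra by blast
  then obtain c where "p = [:c:]"
    using constant_degree degree_eq_zeroE by metis
  then show ?case using no_roots by auto
next
  case (root a p)
  then have "poly_fls p X \<noteq> 0" by fastforce
  moreover have "poly_fls [:a, -1:] X \<noteq> 0" using assms(1)[of a] by simp
  ultimately show ?case unfolding poly_fls_mult by simp
qed simp

text \<open>At a pole the leading term dominates: in Horner form \<open>X * poly_fls p X\<close> has
  negative order, so adding a constant does not change the order.\<close>

lemma subdegree_poly_fls_pole:
  assumes "fls_subdegree X < 0" "p \<noteq> 0"
  shows "poly_fls p X \<noteq> 0 \<and> fls_subdegree (poly_fls p X) = int (degree p) * fls_subdegree X"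
  using assms(2)
proof (induction p)
  case (pCons c p)
  have X: "X \<noteq> 0" using assms(1) by auto
  show ?case
  proof (cases "p = 0")
    case True
    then show ?thesis using pCons by simp
  next
    case False
    then have "poly_fls p X \<noteq> 0" and
      deg: "fls_subdegree (poly_fls p X) = int (degree p) * fls_subdegree X"
      using pCons by auto
    then have nz: "X * poly_fls p X \<noteq> 0" and
      sub: "fls_subdegree (X * poly_fls p X) = int (degree (pCons c p)) * fls_subdegree X"
      using X False by (auto simp: algebra_simps)
    moreover have lt: "fls_subdegree (X * poly_fls p X) < fls_subdegree (fls_const c)"
      unfolding sub using assms(1) False by (simp add: mult_pos_neg)
    ultimately have "fls_subdegree (fls_const c + X * poly_fls p X) = int (degree (pCons c p)) * fls_subdegree X"
      using fls_subdegree_add_eq2[OF nz lt] by simp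
    moreover from this have "fls_const c + X * poly_fls p X \<noteq> 0"
      using lt sub by auto
    ultimately show ?thesis by simp
  qed
qed simp

lemma fps_square_root_exists:
  fixes G :: "complex fps"
  assumes "fps_nth G 0 = y\<^sup>2" "y \<noteq> 0"
  obtains R where "R\<^sup>2 = G" "fps_nth R 0 = y"
proof
  show "(fps_radical (\<lambda>_ _. y) 2 G)\<^sup>2 = G"
    using power_radical[of G "\<lambda>_ _. y" 1] assms by (simp add: numeral_2_eq_2)
qed simp

section \<open>Local parametrisations of the curve and nonvanishing of functions\<close>

locale simple_cubic =
  fixes f :: "complex poly"
  assumes degree_f: "degree f = 3"
    and simple_roots: "poly f x = 0 \<Longrightarrow> poly (pderiv f) x \<noteq> 0"
begin

lemma root_cofactor:
  assumes "poly f x = 0"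
  obtains g where "f = [:- x, 1:] * g" "poly g x \<noteq> 0"
proof -
  obtain g where g: "f = [:- x, 1:] * g"
    using assms by (metis poly_eq_0_iff_dvd dvdE)
  have "poly (pderiv f) x = poly g x"
    unfolding g pderiv_mult by (simp add: pderiv_pCons)
  with g that simple_roots assms show thesis by metis
qed

text \<open>Away from the branch points the abscissa minus \<open>x\<close> is a local parameter,
  and \<open>f\<close> has a power series square root with constant term \<open>y\<close>. At a
  branch point \<open>f\<close> is \<open>[:- x, 1:] * g\<close>, and \<open>X = x + t^2\<close>
  turns the simple zero into the square of \<open>t\<close>.\<close>

lemma affine_parametrisation_exists:
  assumes "y\<^sup>2 = poly f x"
  shows "\<exists>XY. local_parametrisation f (Affine x y) XY"
proof (cases "y = 0")
  case False
  define U :: "complex fps" where "U = fps_const x + fps_X"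
  have U0: "fps_nth U 0 = x" "fps_nth U 1 = 1" by (auto simp: U_def)
  obtain H where H: "poly_fls f (fps_to_fls U) = fps_to_fls H" "fps_nth H 0 = poly f (fps_nth U 0)"
    by (rule poly_fls_fps)
  obtain V where V: "V\<^sup>2 = H" "fps_nth V 0 = y"
    using fps_square_root_exists[of H y] H assms False U0 by metis
  then have "(fps_to_fls V)\<^sup>2 = poly_fls f (fps_to_fls U)"
    by (simp add: H fps_to_fls_power[symmetric])
  then show ?thesis
    using U0 V by (intro exI[of _ "(fps_to_fls U, fps_to_fls V)"]) auto
next
  case True
  obtain g where g: "f = [:- x, 1:] * g" "poly g x \<noteq> 0"
    using root_cofactor assms True by force
  define U :: "complex fps" where "U = fps_const x + fps_X ^ 2"
  have U0: "fps_nth U 0 = x" "fps_nth U 1 = 0" by (auto simp: U_def)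
  obtain H where H: "poly_fls g (fps_to_fls U) = fps_to_fls H" "fps_nth H 0 = poly g (fps_nth U 0)"
    by (rule poly_fls_fps)
  have csq: "csqrt (poly g x) \<noteq> 0" using g by simp
  obtain R where R: "R\<^sup>2 = H" "fps_nth R 0 = csqrt (poly g x)"
    using fps_square_root_exists[of H "csqrt (poly g x)"] H U0 csq by auto
  define V where "V = fps_X * R"
  have V0: "fps_nth V 0 = 0" "fps_nth V 1 \<noteq> 0" using R csq by (auto simp: V_def)
  have "poly_fls f (fps_to_fls U) = (fps_to_fls U - fls_const x) * fps_to_fls H"
    unfolding g(1) poly_fls_mult H by simp
  then have "(fps_to_fls V)\<^sup>2 = poly_fls f (fps_to_fls U)"
    by (simp add: V_def U_def fls_times_fps_to_fls fps_to_fls_power power_mult_distrib flip: R(1))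
  then show ?thesis
    using U0 V0 True by (intro exI[of _ "(fps_to_fls U, fps_to_fls V)"]) auto
qed

text \<open>The witness is \<open>X = t^(-2)\<close> and \<open>Y = t^(-3) R\<close> with
  \<open>R^2 = t^6 f(t^(-2))\<close>. That power series is \<open>G\<close>; it has a square root
  because its constant term is the leading coefficient of \<open>f\<close>.\<close>

lemma infinite_parametrisation_exists: "\<exists>XY. local_parametrisation f Infinity XY"
proof -
  define c0 c1 c2 c3 where c: "c0 = coeff f 0" "c1 = coeff f 1" "c2 = coeff f 2" "c3 = coeff f 3"
  have f: "f = [:c0, c1, c2, c3:]"
    using degree_f
    by (intro poly_eqI) (auto simp: c coeff_pCons numeral_eq_Suc intro: coeff_eq_0 split: nat.split)
  have c3: "c3 \<noteq> 0"
    using degree_f c(4) by (metis degree_0 leading_coeff_0_iff zero_neq_numeral)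
  define G where "G = fps_const c3 + fps_const c2 * fps_X^2 + fps_const c1 * fps_X^4 + fps_const c0 * fps_X^6"
  have "fps_nth G 0 = (csqrt c3)\<^sup>2" by (simp add: G_def)
  then obtain R where R: "R\<^sup>2 = G" "fps_nth R 0 = csqrt c3"
    using fps_square_root_exists[of G "csqrt c3"] c3 by auto
  have R0: "R \<noteq> 0" "subdegree R = 0" using R c3 by (auto intro: subdegreeI)
  define X :: "complex fls" where "X = fls_X_inv ^ 2"
  define Y where "Y = fls_X_inv ^ 3 * fps_to_fls R"
  have cancel: "(fls_X_inv :: complex fls) ^ (m + k) * fls_X ^ k = fls_X_inv ^ m" for m k
  proof -
    have "(fls_X_inv :: complex fls) ^ (m + k) * fls_X ^ k = fls_X_inv ^ m * (fls_X_inv * fls_X) ^ k"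
      by (simp only: power_add power_mult_distrib mult.assoc)
    also have "fls_X_inv * fls_X = (1 :: complex fls)"
      by (simp add: fls_X_inv_times_conv_shift)
    finally show ?thesis by simp
  qed
  have "Y\<^sup>2 = fls_X_inv ^ 6 * fps_to_fls G"
    by (simp add: Y_def power_mult_distrib fps_to_fls_power flip: R(1) power_mult)
  also have "\<dots> = fls_const c3 * fls_X_inv ^ (6 + 0) + fls_const c2 * (fls_X_inv ^ (4 + 2) * fls_X ^ 2)
     + fls_const c1 * (fls_X_inv ^ (2 + 4) * fls_X ^ 4) + fls_const c0 * (fls_X_inv ^ (0 + 6) * fls_X ^ 6)"
    by (simp add: G_def fls_times_fps_to_fls fps_to_fls_power distrib_left mult.left_commute)
  also have "\<dots> = poly_fls f X"
    unfolding cancel by (simp add: f X_def algebra_simps flip: power_mult power_add)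
  finally have "Y\<^sup>2 = poly_fls f X" .
  moreover have "fls_subdegree X = - 2" by (simp add: X_def)
  moreover have "fls_subdegree Y = - 3"
    using R0 by (simp add: Y_def fls_subdegree_fls_to_fps)
  moreover from calculation have "X \<noteq> 0" "Y \<noteq> 0" by auto
  ultimately show ?thesis
    by (intro exI[of _ "(X, Y)"]) (auto simp: fls_divide_subdegree)
qed

text \<open>The choice in the definition fixes one parametrisation at \<open>P\<close> for all
  functions at once, so their orders can be combined. The later computations rest only on its
  defining conditions.\<close>

lemma function_order_parametrisation:
  assumes "P \<in> curve_points f"
  shows "\<exists>X Y. local_parametrisation f P (X, Y) \<and>
    (\<forall>p q r. function_order f P p q r = fls_subdegree ((poly_fls p X + poly_fls q X * Y) / poly_fls r X))"
proof -
  have "\<exists>XY. local_parametrisation f P XY"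
    using assms affine_parametrisation_exists infinite_parametrisation_exists
    unfolding curve_points_def by blast
  then have lp: "local_parametrisation f P (SOME XY. local_parametrisation f P XY)"
    by (rule someI_ex)
  obtain X Y where XY: "(SOME XY. local_parametrisation f P XY) = (X, Y)" by fastforce
  show ?thesis
    using lp XY by (intro exI[of _ X] exI[of _ Y]) (simp add: function_order_def)
qed

lemma Infinity_curve_point: "Infinity \<in> curve_points f"
  by (simp add: curve_points_def)

lemma Affine_curve_point: "Affine x y \<in> curve_points f \<longleftrightarrow> y\<^sup>2 = poly f x"
  by (simp add: curve_points_def)

lemma parametrisation_square: "local_parametrisation f P (X, Y) \<Longrightarrow> Y\<^sup>2 = poly_fls f X"
  by (cases P) auto

text \<open>If \<open>X\<close> were constant, so would be \<open>Y\<^sup>2\<close> and then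
  \<open>Y\<close>, against the nonzero linear coefficient at an affine point. At infinity
  \<open>X\<close> has a pole.\<close>

lemma parametrisation_not_const:
  assumes "local_parametrisation f P (X, Y)"
  shows "X \<noteq> fls_const c"
proof
  assume X: "X = fls_const c"
  show False
  proof (cases P)
    case (Affine x y)
    with assms obtain U V where UV: "X = fps_to_fls U" "Y = fps_to_fls V" "fps_nth U 1 \<noteq> 0 \<or> fps_nth V 1 \<noteq> 0"
      by auto
    have "poly_fls p X = fls_const (poly p c)" for p
      by (induction p) (simp_all add: X fls_plus_const)
    then have "Y\<^sup>2 = (fls_const (csqrt (poly f c)))\<^sup>2"
      using parametrisation_square[OF assms] by (simp flip: fls_const_power)
    then have "Y = fls_const (csqrt (poly f c)) \<or> Y = fls_const (- csqrt (poly f c))"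
      by (simp add: power2_eq_iff)
    then have "V = fps_const (csqrt (poly f c)) \<or> V = fps_const (- csqrt (poly f c))"
      unfolding UV fps_const_to_fls[symmetric] fps_to_fls_eq_iff .
    moreover have "U = fps_const c"
      using X unfolding UV fps_const_to_fls[symmetric] fps_to_fls_eq_iff .
    ultimately show False using UV by auto
  qed (use assms X in auto)
qed

text \<open>This is the norm of \<open>p + q y\<close> down to the polynomials in \<open>x\<close>.
  If it vanished, \<open>p\<^sup>2\<close> and \<open>q\<^sup>2 * f\<close> would have degrees of
  different parity, since \<open>f\<close> has degree 3.\<close>

lemma norm_nonzero:
  assumes "p \<noteq> 0 \<or> q \<noteq> 0"
  shows "p\<^sup>2 - q\<^sup>2 * f \<noteq> 0"
proof
  assume "p\<^sup>2 - q\<^sup>2 * f = 0"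
  then have eq: "p\<^sup>2 = q\<^sup>2 * f" by simp
  have f0: "f \<noteq> 0" using degree_f by auto
  with eq assms have q: "q \<noteq> 0" by auto
  with eq f0 have p: "p \<noteq> 0" by auto
  have "degree (p\<^sup>2) = 2 * degree p" "degree (q\<^sup>2 * f) = 2 * degree q + 3"
    using p q f0 by (simp_all add: degree_power_eq degree_mult_eq degree_f)
  with eq have "2 * degree p = 2 * degree q + 3" by simp
  then show False by presburger
qed

lemma conjugate_product:
  assumes "local_parametrisation f P (X, Y)"
  shows "(poly_fls p X + poly_fls q X * Y) * (poly_fls p X - poly_fls q X * Y) = poly_fls (p\<^sup>2 - q\<^sup>2 * f) X"
proof -
  have "(poly_fls p X + poly_fls q X * Y) * (poly_fls p X - poly_fls q X * Y)
      = (poly_fls p X)\<^sup>2 - (poly_fls q X)\<^sup>2 * Y\<^sup>2"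
    by (simp add: power2_eq_square algebra_simps)
  then show ?thesis
    by (simp add: parametrisation_square[OF assms])
qed

text \<open>The product of the two conjugates is the norm, a nonzero polynomial evaluated at the
  non-constant series \<open>X\<close>.\<close>

lemma function_nonzero:
  assumes "local_parametrisation f P (X, Y)" "p \<noteq> 0 \<or> q \<noteq> 0"
  shows "poly_fls p X + poly_fls q X * Y \<noteq> 0" "poly_fls p X - poly_fls q X * Y \<noteq> 0"
proof -
  have "poly_fls (p\<^sup>2 - q\<^sup>2 * f) X \<noteq> 0"
    using poly_fls_nonzero parametrisation_not_const assms norm_nonzero by metis
  then show "poly_fls p X + poly_fls q X * Y \<noteq> 0" "poly_fls p X - poly_fls q X * Y \<noteq> 0"
    using conjugate_product[OF assms(1), of p q] by auto
qed

lemma poly_fls_param_nonzero: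
  assumes "local_parametrisation f P (X, Y)" "p \<noteq> 0"
  shows "poly_fls p X \<noteq> 0"
  using poly_fls_nonzero parametrisation_not_const assms by metis

lemma function_order_diff:
  assumes "P \<in> curve_points f"
  shows "\<exists>X Y. local_parametrisation f P (X, Y) \<and>
    (\<forall>p q r. (p \<noteq> 0 \<or> q \<noteq> 0) \<and> r \<noteq> 0 \<longrightarrow>
      function_order f P p q r = fls_subdegree (poly_fls p X + poly_fls q X * Y) - fls_subdegree (poly_fls r X))"
proof -
  obtain X Y where lp: "local_parametrisation f P (X, Y)"
    and ord: "\<forall>p q r. function_order f P p q r = fls_subdegree ((poly_fls p X + poly_fls q X * Y) / poly_fls r X)"
    using function_order_parametrisation[OF assms] by blast
  have "function_order f P p q r
        = fls_subdegree (poly_fls p X + poly_fls q X * Y) - fls_subdegree (poly_fls r X)"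
    if "p \<noteq> 0 \<or> q \<noteq> 0" "r \<noteq> 0" for p q r
    using function_nonzero[OF lp] poly_fls_param_nonzero[OF lp] that
    by (simp add: ord fls_divide_subdegree)
  with lp show ?thesis by blast
qed

section \<open>The group of principal divisors\<close>

lemma principal_divisor_add:
  assumes "principal_divisor f D" "principal_divisor f E"
  shows "principal_divisor f (D + E)"
proof -
  from assms(1) obtain p q r where 1: "p \<noteq> 0 \<or> q \<noteq> 0" "r \<noteq> 0"
      "\<And>P. P \<in> curve_points f \<Longrightarrow> Poly_Mapping.lookup D P = function_order f P p q r"
    unfolding principal_divisor_def by blast
  from assms(2) obtain p' q' r' where 2: "p' \<noteq> 0 \<or> q' \<noteq> 0" "r' \<noteq> 0"
      "\<And>P. P \<in> curve_points f \<Longrightarrow> Poly_Mapping.lookup E P = function_order f P p' q' r'"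
    unfolding principal_divisor_def by blast
  \<comment> \<open>Numerator of the product of the two functions, reduced by
    \<open>y\<^sup>2 = f\<close>.\<close>
  define p'' q'' where "p'' = p * p' + q * q' * f" "q'' = p * q' + p' * q"
  have prod: "poly_fls p'' X + poly_fls q'' X * Y = (poly_fls p X + poly_fls q X * Y) * (poly_fls p' X + poly_fls q' X * Y)"
    if "local_parametrisation f P (X, Y)" for P X Y
    unfolding p''_q''_def
    by (simp add: parametrisation_square[OF that, symmetric] power2_eq_square algebra_simps)
  \<comment> \<open>If both reduced coefficients vanished, the product would be zero in every
    parametrisation; the one at infinity excludes this.\<close>
  have nz: "p'' \<noteq> 0 \<or> q'' \<noteq> 0"
  proof -
    obtain X Y where lp: "local_parametrisation f Infinity (X, Y)"
      using infinite_parametrisation_exists by fast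
    have "poly_fls p'' X + poly_fls q'' X * Y \<noteq> 0"
      unfolding prod[OF lp] using function_nonzero[OF lp] 1 2 by simp
    then show ?thesis by auto
  qed
  have "Poly_Mapping.lookup (D + E) P = function_order f P p'' q'' (r * r')"
    if P: "P \<in> curve_points f" for P
  proof -
    obtain X Y where lp: "local_parametrisation f P (X, Y)"
      and ord: "\<forall>p q r. (p \<noteq> 0 \<or> q \<noteq> 0) \<and> r \<noteq> 0 \<longrightarrow>
      function_order f P p q r = fls_subdegree (poly_fls p X + poly_fls q X * Y) - fls_subdegree (poly_fls r X)"
      using function_order_diff[OF P] by blast
    have "fls_subdegree (poly_fls p'' X + poly_fls q'' X * Y)
        = fls_subdegree (poly_fls p X + poly_fls q X * Y) + fls_subdegree (poly_fls p' X + poly_fls q' X * Y)"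
      unfolding prod[OF lp] using function_nonzero[OF lp] 1 2 by simp
    moreover have "fls_subdegree (poly_fls (r * r') X) = fls_subdegree (poly_fls r X) + fls_subdegree (poly_fls r' X)"
      using poly_fls_param_nonzero[OF lp] 1 2 by simp
    ultimately show ?thesis
      using 1 2 nz P by (simp add: ord lookup_add del: poly_fls_mult)
  qed
  moreover have "Poly_Mapping.keys (D + E) \<subseteq> curve_points f"
    using assms Poly_Mapping.keys_add[of D E] by (auto simp: principal_divisor_def)
  moreover have "r * r' \<noteq> 0" using 1 2 by simp
  ultimately show ?thesis
    unfolding principal_divisor_def using nz by blast
qed

lemma principal_divisor_uminus:
  assumes "principal_divisor f D"
  shows "principal_divisor f (- D)"
proof -
  from assms obtain p q r where 1: "p \<noteq> 0 \<or> q \<noteq> 0" "r \<noteq> 0"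
      "\<And>P. P \<in> curve_points f \<Longrightarrow> Poly_Mapping.lookup D P = function_order f P p q r"
    unfolding principal_divisor_def by blast
  \<comment> \<open>The inverse of \<open>(p + q y) / r\<close> is \<open>r (p - q y) / N\<close>:
    multiplying by the conjugate leaves the norm in the denominator.\<close>
  define N where "N = p\<^sup>2 - q\<^sup>2 * f"
  have N: "N \<noteq> 0" unfolding N_def using norm_nonzero 1 by blast
  have "Poly_Mapping.lookup (- D) P = function_order f P (r * p) (- (r * q)) N"
    if P: "P \<in> curve_points f" for P
  proof -
    obtain X Y where lp: "local_parametrisation f P (X, Y)"
      and ord: "\<forall>p q r. (p \<noteq> 0 \<or> q \<noteq> 0) \<and> r \<noteq> 0 \<longrightarrow>
      function_order f P p q r = fls_subdegree (poly_fls p X + poly_fls q X * Y) - fls_subdegree (poly_fls r X)"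
      using function_order_diff[OF P] by blast
    have "poly_fls (r * p) X + poly_fls (- (r * q)) X * Y = poly_fls r X * (poly_fls p X - poly_fls q X * Y)"
      by (simp add: algebra_simps)
    then have "fls_subdegree (poly_fls (r * p) X + poly_fls (- (r * q)) X * Y)
        = fls_subdegree (poly_fls r X) + fls_subdegree (poly_fls p X - poly_fls q X * Y)"
      using function_nonzero[OF lp] poly_fls_param_nonzero[OF lp] 1 by simp
    moreover have "fls_subdegree (poly_fls N X)
        = fls_subdegree (poly_fls p X + poly_fls q X * Y) + fls_subdegree (poly_fls p X - poly_fls q X * Y)"
      unfolding N_def conjugate_product[OF lp, symmetric] using function_nonzero[OF lp] 1 by simp
    ultimately show ?thesis
      using 1 N P by (simp add: ord del: poly_fls_mult poly_fls_minus)
  qed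
  moreover have "Poly_Mapping.keys (- D) \<subseteq> curve_points f"
    using assms by (simp add: principal_divisor_def)
  moreover have "r * p \<noteq> 0 \<or> - (r * q) \<noteq> 0" using 1 by simp
  ultimately show ?thesis
    unfolding principal_divisor_def using N by blast
qed

lemma principal_divisor_diff:
  "principal_divisor f D \<Longrightarrow> principal_divisor f E \<Longrightarrow> principal_divisor f (D - E)"
  using principal_divisor_add[of D "- E"] principal_divisor_uminus[of E] by simp

lemma principal_divisor_0: "principal_divisor f 0"
proof -
  have "\<forall>P \<in> curve_points f. Poly_Mapping.lookup 0 P = function_order f P 1 0 1"
  proof
    fix P assume "P \<in> curve_points f"
    from function_order_parametrisation[OF this]
    show "Poly_Mapping.lookup 0 P = function_order f P 1 0 1" by auto
  qed
  then show ?thesis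
    unfolding principal_divisor_def
    by (intro conjI exI[of _ 1] exI[of _ "0 :: complex poly"]) auto
qed

section \<open>Orders at the points of the curve\<close>

lemma affine_value:
  assumes "local_parametrisation f (Affine x y) (X, Y)"
  obtains H where "poly_fls p X + poly_fls q X * Y = fps_to_fls H" "fps_nth H 0 = poly p x + poly q x * y"
proof -
  from assms obtain U V where UV: "X = fps_to_fls U" "Y = fps_to_fls V" "fps_nth U 0 = x" "fps_nth V 0 = y"
    by auto
  obtain A where "poly_fls p X = fps_to_fls A" "fps_nth A 0 = poly p x"
    using poly_fls_fps[of p U] UV by metis
  moreover obtain B where "poly_fls q X = fps_to_fls B" "fps_nth B 0 = poly q x"
    using poly_fls_fps[of q U] UV by metis
  ultimately show thesis
    using that[of "A + B * V"] UV by (simp add: fls_times_fps_to_fls)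
qed

lemma affine_order_nonneg:
  assumes "local_parametrisation f (Affine x y) (X, Y)"
  shows "fls_subdegree (poly_fls p X + poly_fls q X * Y) \<ge> 0"
  using affine_value[OF assms, of p q] by (metis fls_subdegree_fls_to_fps_gt0)

lemma affine_order_eq_0:
  assumes "local_parametrisation f (Affine x y) (X, Y)" "poly p x + poly q x * y \<noteq> 0"
  shows "fls_subdegree (poly_fls p X + poly_fls q X * Y) = 0"
proof -
  obtain H where H: "poly_fls p X + poly_fls q X * Y = fps_to_fls H" "fps_nth H 0 = poly p x + poly q x * y"
    using affine_value[OF assms(1)] by blast
  then have "subdegree H = 0" using assms(2) by (intro subdegreeI) auto
  then show ?thesis by (simp add: H fls_subdegree_fls_to_fps)
qed

lemma affine_order_pos:
  assumes "local_parametrisation f (Affine x y) (X, Y)" "poly p x + poly q x * y = 0" "p \<noteq> 0 \<or> q \<noteq> 0"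
  shows "fls_subdegree (poly_fls p X + poly_fls q X * Y) > 0"
proof -
  obtain H where H: "poly_fls p X + poly_fls q X * Y = fps_to_fls H" "fps_nth H 0 = poly p x + poly q x * y"
    using affine_value[OF assms(1)] by blast
  have "H \<noteq> 0" using function_nonzero(1)[OF assms(1,3)] unfolding H by auto
  then have "subdegree H > 0"
    using H assms(2) by (metis gr0I nth_subdegree_nonzero)
  then show ?thesis by (simp add: H fls_subdegree_fls_to_fps)
qed

text \<open>Since \<open>f\<close> has a simple root, \<open>Y\<^sup>2\<close> is
  \<open>X - x\<close> times a unit, so \<open>X - x\<close> has twice the order of
  \<open>Y\<close>. The linear coefficients do not both vanish, so one of the two orders is 1, and
  by parity it is that of \<open>Y\<close>.\<close>

lemma orders_at_branch_point:
  assumes "local_parametrisation f (Affine x 0) (X, Y)"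
  shows "fls_subdegree Y = 1" "fls_subdegree (X - fls_const x) = 2"
proof -
  from assms obtain U V where UV: "X = fps_to_fls U" "Y = fps_to_fls V" "fps_nth U 0 = x" "fps_nth V 0 = 0"
     "fps_nth U 1 \<noteq> 0 \<or> fps_nth V 1 \<noteq> 0"
    by auto
  have Y2: "Y\<^sup>2 = poly_fls f X" by (rule parametrisation_square[OF assms])
  obtain H where "poly_fls f X = fps_to_fls H" "fps_nth H 0 = poly f x"
    using poly_fls_fps[of f U] UV by metis
  moreover from this have "V\<^sup>2 = H"
    using Y2 UV by (simp add: fps_to_fls_power[symmetric])
  ultimately have "poly f x = 0" using UV(4) by (auto simp: power2_eq_square)
  then obtain g where g: "f = [:- x, 1:] * g" "poly g x \<noteq> 0"
    by (rule root_cofactor)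
  have X0: "X - fls_const x \<noteq> 0" using parametrisation_not_const[OF assms, of x] by simp
  have g0: "fls_subdegree (poly_fls g X) = 0"
    using affine_order_eq_0[OF assms, of g 0] g by simp
  have gnz: "poly_fls g X \<noteq> 0" using poly_fls_param_nonzero[OF assms, of g] g(2) by fastforce
  have eq: "Y\<^sup>2 = (X - fls_const x) * poly_fls g X"
    unfolding Y2 by (subst g(1)) (simp only: poly_fls_mult, simp)
  have double: "2 * fls_subdegree Y = fls_subdegree (X - fls_const x)"
    using arg_cong[OF eq, of fls_subdegree] X0 gnz g0 by (simp add: fls_subdegree_pow)
  have "fls_subdegree Y = 1"
  proof (cases "fps_nth V 1 = 0")
    case False
    then have "subdegree V = 1" using UV(4) by (intro subdegreeI) auto
    then show ?thesis by (simp add: UV fls_subdegree_fls_to_fps)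
  next
    case True
    then have "subdegree (U - fps_const x) = 1" using UV by (intro subdegreeI) auto
    moreover have "X - fls_const x = fps_to_fls (U - fps_const x)" by (simp add: UV)
    ultimately have "fls_subdegree (X - fls_const x) = 1"
      by (simp add: fls_subdegree_fls_to_fps del: fps_to_fls_minus)
    with double show ?thesis by presburger
  qed
  with double show "fls_subdegree Y = 1" "fls_subdegree (X - fls_const x) = 2" by auto
qed

lemma order_X_at_affine_point:
  assumes "local_parametrisation f (Affine x y) (X, Y)"
  shows "fls_subdegree (X - fls_const c) = (if c \<noteq> x then 0 else if y = 0 then 2 else 1)"
proof -
  consider "c \<noteq> x" | "c = x" "y = 0" | "c = x" "y \<noteq> 0" by blast
  then show ?thesis
  proof cases
    case 1
    then show ?thesis using affine_order_eq_0[OF assms, of "[:- c, 1:]" 0] by simp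
  next
    case 2
    then show ?thesis using orders_at_branch_point assms by simp
  next
    case 3
    from assms obtain U V where UV: "X = fps_to_fls U" "Y = fps_to_fls V" "fps_nth U 0 = x" "fps_nth V 0 = y"
     "fps_nth U 1 \<noteq> 0 \<or> fps_nth V 1 \<noteq> 0"
      by auto
    have "fps_nth U 1 \<noteq> 0"
    proof
      \<comment> \<open>A zero linear coefficient of \<open>U\<close> is inherited by
        \<open>f(X) = Y\<^sup>2\<close>. There the linear coefficient is \<open>2 * y\<close> times
        that of \<open>V\<close>, so \<open>V\<close> loses its linear term too.\<close>
      assume U1: "fps_nth U 1 = 0"
      have "\<exists>H. poly_fls p X = fps_to_fls H \<and> fps_nth H 1 = 0" for p
      proof (induction p)
        case (pCons a p)
        then obtain H where "poly_fls p X = fps_to_fls H" "fps_nth H 1 = 0" by blast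
        then show ?case
          using U1 by (intro exI[of _ "fps_const a + U * H"]) (simp add: UV fls_times_fps_to_fls fps_mult_nth)
      qed (auto intro: exI[of _ 0])
      then obtain H where H: "poly_fls f X = fps_to_fls H" "fps_nth H 1 = 0" by blast
      have "V\<^sup>2 = H"
        using parametrisation_square[OF assms] H by (simp add: UV fps_to_fls_power[symmetric])
      then have "fps_nth V 1 = 0"
        using H(2) 3 UV(4) by (auto simp: power2_eq_square fps_mult_nth)
      with UV(5) U1 show False by simp
    qed
    then have "subdegree (U - fps_const x) = 1" using UV by (intro subdegreeI) auto
    moreover have "X - fls_const x = fps_to_fls (U - fps_const x)" by (simp add: UV)
    ultimately show ?thesis
      using 3 by (simp add: fls_subdegree_fls_to_fps del: fps_to_fls_minus)
  qed
qed

text \<open>Comparing orders in \<open>Y\<^sup>2 = f(X)\<close> makes twice the order of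
  \<open>Y\<close> equal to three times that of \<open>X\<close>. As \<open>x / y\<close> is a local
  parameter, the orders differ by 1, and both are determined.\<close>

lemma order_at_Infinity:
  assumes "local_parametrisation f Infinity (X, Y)"
  shows "fls_subdegree X = - 2" "fls_subdegree Y = - 3"
proof -
  have X: "fls_subdegree X < 0" and XY: "fls_subdegree (X / Y) = 1" using assms by auto
  have f0: "f \<noteq> 0" using degree_f by auto
  have sq: "Y\<^sup>2 = poly_fls f X" by (rule parametrisation_square[OF assms])
  have pole: "poly_fls f X \<noteq> 0" "fls_subdegree (poly_fls f X) = 3 * fls_subdegree X"
    using subdegree_poly_fls_pole[OF X f0] degree_f by simp_all
  have "2 * fls_subdegree Y = 3 * fls_subdegree X"
    using arg_cong[OF sq, of fls_subdegree] pole by (simp add: fls_subdegree_pow)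
  moreover have "Y \<noteq> 0" "X \<noteq> 0" using sq pole X by auto
  then have "fls_subdegree X - fls_subdegree Y = 1"
    using XY by (simp add: fls_divide_subdegree)
  ultimately show "fls_subdegree X = - 2" "fls_subdegree Y = - 3" by auto
qed

section \<open>Divisors of lines\<close>

lemma principal_divisor_vertical_line:
  assumes "y\<^sup>2 = poly f x"
  shows "principal_divisor f
    (frag_of (Affine x y) + frag_of (Affine x (- y)) - frag_cmul 2 (frag_of Infinity))" (is "principal_divisor f ?D")
proof -
  have "Poly_Mapping.lookup ?D P = function_order f P [:- x, 1:] 0 1" if P: "P \<in> curve_points f" for P
  proof -
    obtain X Y where lp: "local_parametrisation f P (X, Y)"
      and ord: "\<forall>p q r. function_order f P p q r = fls_subdegree ((poly_fls p X + poly_fls q X * Y) / poly_fls r X)"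
      using function_order_parametrisation[OF P] by blast
    have fo: "function_order f P [:- x, 1:] 0 1 = fls_subdegree (X - fls_const x)"
      by (simp add: ord)
    show ?thesis
    proof (cases P)
      case (Affine x0 y0)
      have "y0\<^sup>2 = poly f x0" using P Affine Affine_curve_point by simp
      then have "x = x0 \<Longrightarrow> y0 = y \<or> y0 = - y"
        using assms by (simp flip: power2_eq_iff)
      then show ?thesis
        using order_X_at_affine_point[OF lp[unfolded Affine], of x] fo unfolding Affine
        by (auto simp: lookup_add lookup_minus)
    next
      case Infinity
      have X: "fls_subdegree X = - 2" using lp order_at_Infinity Infinity by blast
      then have "X \<noteq> 0" by auto
      then have "fls_subdegree (X - fls_const x) = - 2"
        using fls_subdegree_diff_eq1[of X "fls_const x"] X by simp
      then show ?thesis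
        unfolding fo unfolding Infinity by (simp add: lookup_add lookup_minus)
    qed
  qed
  moreover have "Poly_Mapping.keys ?D \<subseteq> curve_points f"
  proof
    fix P assume "P \<in> Poly_Mapping.keys ?D"
    then have "P \<in> {Affine x y, Affine x (- y), Infinity}"
      by (auto simp: in_keys_iff lookup_add lookup_minus split: if_splits)
    then show "P \<in> curve_points f" using assms by (auto simp: curve_points_def)
  qed
  ultimately show ?thesis
    unfolding principal_divisor_def
    by (intro conjI exI[of _ "[:- x, 1:]"] exI[of _ "0 :: complex poly"] exI[of _ "1 :: complex poly"]) auto
qed

text \<open>The orders of \<open>Y - l\<close> and \<open>Y + l\<close> add up to that of
  \<open>f - l\<^sup>2\<close>, which is read off from its roots. Off the branch points
  \<open>Y + l\<close> has the value \<open>2 * y0\<close> and contributes nothing. At a branch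
  point both factors have order 1 and \<open>X - x0\<close> has order 2.\<close>

lemma order_line_affine:
  assumes norm: "f - [:h, m:]\<^sup>2 = smult e ([:- x1, 1:] * [:- x2, 1:] * [:- x3, 1:])" and e: "e \<noteq> 0"
    and curve: "y0\<^sup>2 = poly f x0"
    and lp: "local_parametrisation f (Affine x0 y0) (X, Y)"
    and y0: "y0 = poly [:h, m:] x0"
  shows "fls_subdegree (Y - poly_fls [:h, m:] X) =
    (if x0 = x1 then 1 else 0) + (if x0 = x2 then 1 else 0) + (if x0 = x3 then 1 else 0)"
proof -
  define l where "l = [:h, m:]"
  have X: "X - fls_const c \<noteq> 0" for c using parametrisation_not_const[OF lp] by simp
  have nz: "Y - poly_fls l X \<noteq> 0" "Y + poly_fls l X \<noteq> 0"
    using function_nonzero[OF lp, of l 1] by (auto simp: add.commute)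
  have "(Y - poly_fls l X) * (Y + poly_fls l X) = poly_fls (f - l\<^sup>2) X"
    using parametrisation_square[OF lp] by (simp add: power2_eq_square algebra_simps)
  also have "\<dots> = fls_const e * ((X - fls_const x1) * (X - fls_const x2) * (X - fls_const x3))"
    unfolding l_def norm by (simp only: poly_fls_smult poly_fls_mult) simp
  finally have "fls_subdegree (Y - poly_fls l X) + fls_subdegree (Y + poly_fls l X)
      = fls_subdegree (X - fls_const x1) + fls_subdegree (X - fls_const x2) + fls_subdegree (X - fls_const x3)"
    using nz X e by (metis fls_const_nonzero fls_const_subdegree fls_subdegree_mult mult_eq_0_iff add_0)
  note sum = this[unfolded order_X_at_affine_point[OF lp]]
  show ?thesis
  proof (cases "y0 = 0")
    case False
    have "poly l x0 + poly 1 x0 * y0 = 2 * y0"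
      unfolding l_def y0 by simp
    then have "fls_subdegree (Y + poly_fls l X) = 0"
      using affine_order_eq_0[OF lp, of l 1] False by (simp add: add.commute)
    then show ?thesis using sum False by (auto simp: l_def)
  next
    case True
    have Y: "fls_subdegree Y = 1" using orders_at_branch_point lp True by blast
    then have "Y \<noteq> 0" by auto
    \<comment> \<open>The line passes through the branch point, so \<open>l(X)\<close> is a multiple
      of \<open>X - x0\<close>; being zero or of order 2, it leaves the order 1 of \<open>Y\<close>
      unchanged.\<close>
    have "h = - m * x0" using y0 True by (simp add: l_def eq_neg_iff_add_eq_0 mult.commute)
    then have lX: "poly_fls l X = fls_const m * (X - fls_const x0)"
      by (simp add: l_def algebra_simps)
    have "fls_subdegree (Y - poly_fls l X) = 1 \<and> fls_subdegree (Y + poly_fls l X) = 1"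
    proof (cases "m = 0")
      case True
      then show ?thesis using lX Y by simp
    next
      case False
      then have "fls_subdegree (poly_fls l X) = 2"
        unfolding lX using X[of x0] order_X_at_affine_point[OF lp, of x0] True by simp
      then show ?thesis
        using Y \<open>Y \<noteq> 0\<close> fls_subdegree_add_eq1[of Y] fls_subdegree_diff_eq1[of Y] by simp
    qed
    then show ?thesis using sum True by (auto simp: l_def split: if_splits)
  qed
qed

text \<open>This is the divisor of \<open>y - l(x)\<close>. Giving the intersections through the
  factorisation of \<open>f - l\<^sup>2\<close> allows repeated abscissae, so tangents of the curve
  are included. The triple pole is that of \<open>y\<close>, as \<open>l\<close> has a pole of order
  at most 2.\<close>

lemma principal_divisor_line:
  assumes norm: "f - [:h, m:]\<^sup>2 = smult e ([:- x1, 1:] * [:- x2, 1:] * [:- x3, 1:])" and e: "e \<noteq> 0"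
  defines "l \<equiv> poly [:h, m:]"
  shows "principal_divisor f
    (frag_of (Affine x1 (l x1)) + frag_of (Affine x2 (l x2)) + frag_of (Affine x3 (l x3))
      - frag_cmul 3 (frag_of Infinity))" (is "principal_divisor f ?D")
proof -
  have on_curve: "(l x)\<^sup>2 = poly f x" if "x \<in> {x1, x2, x3}" for x
  proof -
    have "poly (smult e ([:- x1, 1:] * [:- x2, 1:] * [:- x3, 1:])) x = 0"
      unfolding poly_smult poly_mult using that by auto
    then show ?thesis
      unfolding norm[symmetric] l_def by simp
  qed
  have "Poly_Mapping.lookup ?D P = function_order f P (- [:h, m:]) 1 1" if P: "P \<in> curve_points f" for P
  proof -
    obtain X Y where lp: "local_parametrisation f P (X, Y)"
      and ord: "\<forall>p q r. function_order f P p q r = fls_subdegree ((poly_fls p X + poly_fls q X * Y) / poly_fls r X)"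
      using function_order_parametrisation[OF P] by blast
    have fo: "function_order f P (- [:h, m:]) 1 1 = fls_subdegree (Y - poly_fls [:h, m:] X)"
      unfolding ord[rule_format] poly_fls_minus by (simp add: algebra_simps)
    show ?thesis
    proof (cases P)
      case (Affine x0 y0)
      show ?thesis
      proof (cases "y0 = l x0")
        case True
        then show ?thesis
          using order_line_affine[OF norm e _ lp[unfolded Affine]] P
          unfolding fo unfolding Affine Affine_curve_point by (auto simp: lookup_add lookup_minus l_def)
      next
        case False
        then have "fls_subdegree (Y - poly_fls [:h, m:] X) = 0"
          using affine_order_eq_0[OF lp[unfolded Affine], of "- [:h, m:]" 1] unfolding poly_fls_minus
          by (simp add: l_def algebra_simps)
        then show ?thesis
          unfolding fo unfolding Affine using False by (auto simp: lookup_add lookup_minus)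
      qed
    next
      case Infinity
      have XY: "fls_subdegree X = - 2" "fls_subdegree Y = - 3"
        using lp order_at_Infinity Infinity by blast+
      have "fls_subdegree (poly_fls [:h, m:] X) > - 3"
      proof (cases "[:h, m:] = 0")
        case False
        have "fls_subdegree (poly_fls [:h, m:] X) = int (degree [:h, m:]) * fls_subdegree X"
          using subdegree_poly_fls_pole[of X "[:h, m:]"] False XY by auto
        then show ?thesis using XY by (simp split: if_splits)
      qed auto
      moreover have "Y \<noteq> 0" using XY by auto
      ultimately have "fls_subdegree (Y - poly_fls [:h, m:] X) = - 3"
        using fls_subdegree_diff_eq1[of Y "poly_fls [:h, m:] X"] XY by simp
      then show ?thesis
        unfolding fo unfolding Infinity by (simp add: lookup_add lookup_minus)
    qed
  qed
  moreover have "Poly_Mapping.keys ?D \<subseteq> curve_points f"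
  proof
    fix P assume "P \<in> Poly_Mapping.keys ?D"
    then have "P \<in> {Affine x1 (l x1), Affine x2 (l x2), Affine x3 (l x3), Infinity}"
      by (auto simp: in_keys_iff lookup_add lookup_minus split: if_splits)
    then show "P \<in> curve_points f" using on_curve by (auto simp: curve_points_def)
  qed
  ultimately show ?thesis
    unfolding principal_divisor_def
    by (intro conjI exI[of _ "- [:h, m:]"] exI[of _ "1 :: complex poly"] exI[of _ "1 :: complex poly"]) auto
qed

section \<open>Functions without affine poles\<close>

text \<open>The affine curve is smooth, so its regular functions are the polynomials in
  \<open>x\<close> and \<open>y\<close>. At a root of \<open>r\<close> regularity forces
  \<open>p\<close> and \<open>q\<close> to vanish; the common linear factor is cancelled and the
  degree of \<open>r\<close> drops.\<close>

lemma affine_regular_imp_polynomial: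
  assumes "p \<noteq> 0 \<or> q \<noteq> 0" "r \<noteq> 0"
    and "\<And>x y. y\<^sup>2 = poly f x \<Longrightarrow> function_order f (Affine x y) p q r \<ge> 0"
  shows "r dvd p \<and> r dvd q"
  using assms
proof (induction "degree r" arbitrary: p q r)
  case 0
  then have "is_unit r" by (simp add: is_unit_iff_degree)
  then show ?case by (auto intro: unit_imp_dvd)
next
  case (Suc n)
  have "\<not> constant (poly r)"
    using Suc.hyps(2) constant_degree[of r] by simp
  then obtain x where rx: "poly r x = 0"
    using fundamental_theorem_of_algebra by blast
  then obtain r' where r': "r = [:- x, 1:] * r'"
    by (metis poly_eq_0_iff_dvd dvdE)
  \<comment> \<open>One suitable point over \<open>x\<close> suffices. If \<open>p + q y\<close>
    vanishes at the principal root, the conjugate point is taken, since vanishing there as well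
    forces \<open>p\<close> and \<open>q\<close> to vanish at \<open>x\<close>. At a branch point
    only \<open>p\<close> is obtained in this way.\<close>
  have "\<exists>y. y\<^sup>2 = poly f x \<and> (poly p x + poly q x * y = 0 \<longrightarrow> poly p x = 0 \<and> (y \<noteq> 0 \<longrightarrow> poly q x = 0))"
  proof (cases "poly p x + poly q x * csqrt (poly f x) = 0 \<and> poly f x \<noteq> 0")
    case True
    have "poly p x = 0 \<and> poly q x = 0" if "poly p x - poly q x * csqrt (poly f x) = 0"
      using True that by (auto simp: add_eq_0_iff)
    then show ?thesis
      by (intro exI[of _ "- csqrt (poly f x)"]) simp
  next
    case False
    then show ?thesis by (intro exI[of _ "csqrt (poly f x)"]) auto
  qed
  then obtain y where y: "y\<^sup>2 = poly f x"
    and impl: "poly p x + poly q x * y = 0 \<longrightarrow> poly p x = 0 \<and> (y \<noteq> 0 \<longrightarrow> poly q x = 0)"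
    by blast
  obtain X Y where lp: "local_parametrisation f (Affine x y) (X, Y)"
      and ord: "\<forall>p q r. (p \<noteq> 0 \<or> q \<noteq> 0) \<and> r \<noteq> 0 \<longrightarrow>
      function_order f (Affine x y) p q r = fls_subdegree (poly_fls p X + poly_fls q X * Y) - fls_subdegree (poly_fls r X)"
    using function_order_diff[of "Affine x y"] y Affine_curve_point by blast
  have r0: "r' \<noteq> 0" using r' Suc.prems by auto
  have "fls_subdegree (poly_fls r X) = (if y = 0 then 2 else 1) + fls_subdegree (poly_fls r' X)"
  proof -
    have "poly_fls r X = (X - fls_const x) * poly_fls r' X"
      unfolding r' poly_fls_mult by simp
    then show ?thesis
      using poly_fls_param_nonzero[OF lp r0] parametrisation_not_const[OF lp, of x]
      by (simp add: order_X_at_affine_point[OF lp])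
  qed
  moreover have "fls_subdegree (poly_fls r' X) \<ge> 0"
    using affine_order_nonneg[OF lp, of r' 0] by simp
  moreover have "fls_subdegree (poly_fls p X + poly_fls q X * Y) - fls_subdegree (poly_fls r X) \<ge> 0"
    using Suc.prems(3)[OF y] ord Suc.prems by simp
  ultimately have sub: "fls_subdegree (poly_fls p X + poly_fls q X * Y) \<ge> (if y = 0 then 2 else 1)"
    by (auto split: if_splits)
  then have "poly p x + poly q x * y = 0"
    using affine_order_eq_0[OF lp, of p q] by (auto split: if_splits)
  with impl have px: "poly p x = 0" and qx: "y \<noteq> 0 \<Longrightarrow> poly q x = 0" by auto
  obtain p' where p': "p = [:- x, 1:] * p'" using px by (metis poly_eq_0_iff_dvd dvdE)
  \<comment> \<open>At a branch point \<open>r\<close> contributes order at least 2. If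
    \<open>q\<close> did not vanish there, \<open>q(X) * Y\<close> would have order 1 and
    \<open>p(X)\<close> order at least 2, so the sum would have order only 1.\<close>
  have "poly q x = 0"
  proof (rule ccontr)
    assume q: "poly q x \<noteq> 0"
    with qx have y0: "y = 0" by blast
    have lp0: "local_parametrisation f (Affine x 0) (X, Y)" using lp y0 by simp
    have Y: "fls_subdegree Y = 1" "Y \<noteq> 0" using orders_at_branch_point[OF lp0] by auto
    have "poly_fls q X \<noteq> 0" using poly_fls_param_nonzero[OF lp, of q] q by fastforce
    then have qY: "poly_fls q X * Y \<noteq> 0" "fls_subdegree (poly_fls q X * Y) = 1"
      using Y affine_order_eq_0[OF lp, of q 0] q by simp_all
    have "fls_subdegree (poly_fls p X + poly_fls q X * Y) = 1"
    proof (cases "p = 0")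
      case False
      then have "p' \<noteq> 0" using p' by auto
      have "poly_fls p X = (X - fls_const x) * poly_fls p' X"
        unfolding p' poly_fls_mult by simp
      then have "fls_subdegree (poly_fls p X) = 2 + fls_subdegree (poly_fls p' X)"
        using poly_fls_param_nonzero[OF lp \<open>p' \<noteq> 0\<close>] parametrisation_not_const[OF lp, of x] y0
        by (simp add: order_X_at_affine_point[OF lp])
      moreover have "fls_subdegree (poly_fls p' X) \<ge> 0"
        using affine_order_nonneg[OF lp, of p' 0] by simp
      ultimately show ?thesis
        using fls_subdegree_add_eq2[of "poly_fls q X * Y" "poly_fls p X"] qY by simp
    qed (use qY in simp)
    then show False using sub y0 by simp
  qed
  then obtain q' where q': "q = [:- x, 1:] * q'" by (metis poly_eq_0_iff_dvd dvdE)
  have nz: "p' \<noteq> 0 \<or> q' \<noteq> 0" using p' q' Suc.prems by auto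
  have "degree r' = n"
    using Suc.hyps(2) r0 by (simp add: r' degree_mult_eq del: mult_pCons_left)
  moreover have "function_order f (Affine x' y') p' q' r' \<ge> 0" if y': "y'\<^sup>2 = poly f x'" for x' y'
  proof -
    obtain X Y where lp: "local_parametrisation f (Affine x' y') (X, Y)"
      and ord: "\<forall>p q r. (p \<noteq> 0 \<or> q \<noteq> 0) \<and> r \<noteq> 0 \<longrightarrow>
      function_order f (Affine x' y') p q r = fls_subdegree (poly_fls p X + poly_fls q X * Y) - fls_subdegree (poly_fls r X)"
      using function_order_diff[of "Affine x' y'"] y' Affine_curve_point by blast
    have X: "X - fls_const x \<noteq> 0" using parametrisation_not_const[OF lp, of x] by simp
    have "poly_fls p X + poly_fls q X * Y = (X - fls_const x) * (poly_fls p' X + poly_fls q' X * Y)"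
      unfolding p' q' poly_fls_mult by (simp add: algebra_simps)
    moreover have "poly_fls r X = (X - fls_const x) * poly_fls r' X"
      unfolding r' poly_fls_mult by simp
    ultimately have "function_order f (Affine x' y') p q r = function_order f (Affine x' y') p' q' r'"
      using ord Suc.prems nz r0 X function_nonzero[OF lp nz] poly_fls_param_nonzero[OF lp r0] by simp
    then show ?thesis using Suc.prems(3)[OF y'] by simp
  qed
  ultimately have "r' dvd p' \<and> r' dvd q'"
    using Suc.hyps(1)[of r' p' q'] nz r0 by blast
  then show ?case unfolding p' q' r' by (metis dvd_refl mult_dvd_mono)
qed

text \<open>
  A function whose only pole is a double one at infinity is a polynomial in \<open>x\<close> alone, so its
  zeros are symmetric under \<open>y \<mapsto> - y\<close>.
\<close>
lemma principal_difference_of_points: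
  assumes D: "principal_divisor f (frag_of (Affine x y) - frag_of (Affine x' y'))"
    and curve: "y\<^sup>2 = poly f x" "y'\<^sup>2 = poly f x'" and y: "y \<noteq> 0"
  shows "Affine x y = Affine x' y'"
proof (rule ccontr)
  assume ne: "Affine x y \<noteq> Affine x' y'"
  \<comment> \<open>Adding the divisor of the vertical line through the second point trades the
    affine pole for a zero at its conjugate and a double pole at infinity.\<close>
  define E where "E = frag_of (Affine x y) + frag_of (Affine x' (- y')) - frag_cmul 2 (frag_of Infinity)"
  have "E = (frag_of (Affine x y) - frag_of (Affine x' y'))
      + (frag_of (Affine x' y') + frag_of (Affine x' (- y')) - frag_cmul 2 (frag_of Infinity))"
    by (simp add: E_def)
  then have "principal_divisor f E"
    using principal_divisor_add[OF D principal_divisor_vertical_line[OF curve(2)]] by metis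
  then obtain p q r where pqr: "p \<noteq> 0 \<or> q \<noteq> 0" "r \<noteq> 0"
      "\<And>P. P \<in> curve_points f \<Longrightarrow> Poly_Mapping.lookup E P = function_order f P p q r"
    unfolding principal_divisor_def by blast
  have E: "Poly_Mapping.lookup E P =
      (if P = Affine x y then 1 else 0) + (if P = Affine x' (- y') then 1 else 0) - (if P = Infinity then 2 else 0)" for P
    by (simp add: E_def lookup_add lookup_minus)
  have "function_order f (Affine u v) p q r \<ge> 0" if "v\<^sup>2 = poly f u" for u v
    using pqr(3)[of "Affine u v"] that E[of "Affine u v"] by (auto simp: Affine_curve_point split: if_splits)
  then have "r dvd p \<and> r dvd q"
    using affine_regular_imp_polynomial[OF pqr(1,2)] by blast
  then obtain A B where AB: "p = r * A" "q = r * B" by (auto elim!: dvdE)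
  have AB0: "A \<noteq> 0 \<or> B \<noteq> 0" using pqr AB by auto
  have order_eq: "\<exists>X Y. local_parametrisation f P (X, Y) \<and>
      Poly_Mapping.lookup E P = fls_subdegree (poly_fls A X + poly_fls B X * Y)" if P: "P \<in> curve_points f" for P
  proof -
    obtain X Y where lp: "local_parametrisation f P (X, Y)"
      and ord: "\<forall>p q r. (p \<noteq> 0 \<or> q \<noteq> 0) \<and> r \<noteq> 0 \<longrightarrow>
      function_order f P p q r = fls_subdegree (poly_fls p X + poly_fls q X * Y) - fls_subdegree (poly_fls r X)"
      using function_order_diff[OF P] by blast
    have "poly_fls p X + poly_fls q X * Y = poly_fls r X * (poly_fls A X + poly_fls B X * Y)"
      by (simp add: AB algebra_simps)
    then have "function_order f P p q r = fls_subdegree (poly_fls A X + poly_fls B X * Y)"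
      using ord pqr function_nonzero[OF lp AB0] poly_fls_param_nonzero[OF lp pqr(2)] by simp
    with lp pqr(3)[OF P] show ?thesis by auto
  qed
  \<comment> \<open>At infinity \<open>A(X)\<close> has even order, while \<open>B(X) * Y\<close>
    has odd order at most -3. The two cannot cancel, so a sum of order -2 leaves no room for
    \<open>B\<close>.\<close>
  have "B = 0"
  proof (rule ccontr)
    assume B: "B \<noteq> 0"
    obtain X Y where lp: "local_parametrisation f Infinity (X, Y)"
      and sub: "fls_subdegree (poly_fls A X + poly_fls B X * Y) = - 2"
      using order_eq[OF Infinity_curve_point] E by auto
    have XY: "fls_subdegree X = - 2" "fls_subdegree Y = - 3" using order_at_Infinity[OF lp] .
    then have "Y \<noteq> 0" by auto
    then have BY: "poly_fls B X * Y \<noteq> 0" "fls_subdegree (poly_fls B X * Y) = - 2 * int (degree B) - 3"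
      using subdegree_poly_fls_pole[of X B] XY B by auto
    show False
    proof (cases "A = 0")
      case True
      then show False using sub BY by simp
    next
      case False
      then have A: "poly_fls A X \<noteq> 0" "fls_subdegree (poly_fls A X) = - 2 * int (degree A)"
        using subdegree_poly_fls_pole[of X A] XY by auto
      have "- 2 * int (degree A) \<noteq> - 2 * int (degree B) - 3" by presburger
      then consider "fls_subdegree (poly_fls A X) < fls_subdegree (poly_fls B X * Y)"
        | "fls_subdegree (poly_fls B X * Y) < fls_subdegree (poly_fls A X)"
        unfolding A BY by linarith
      then show False
      proof cases
        case 1
        then have "- 2 * int (degree A) = - 2" "- 2 * int (degree A) < - 2 * int (degree B) - 3"
          using fls_subdegree_add_eq1[OF A(1) 1] sub A(2) BY(2) by auto
        then show False by presburger
      next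
        case 2
        then show False
          using fls_subdegree_add_eq2[OF BY(1) 2] sub BY(2) by simp
      qed
    qed
  qed
  then have A: "A \<noteq> 0" using AB0 by simp
  have "poly A x = 0"
  proof -
    obtain X Y where lp: "local_parametrisation f (Affine x y) (X, Y)"
      and sub: "Poly_Mapping.lookup E (Affine x y) = fls_subdegree (poly_fls A X + poly_fls B X * Y)"
      using order_eq[of "Affine x y"] curve Affine_curve_point by blast
    have "fls_subdegree (poly_fls A X) > 0"
      using sub E[of "Affine x y"] \<open>B = 0\<close> by (auto split: if_splits)
    then show ?thesis using affine_order_eq_0[OF lp, of A 0] by auto
  qed
  \<comment> \<open>A polynomial in \<open>x\<close> vanishing at the first point also vanishes at
    its conjugate, which must then be one of the zeros of \<open>E\<close>.\<close>
  have c: "Affine x (- y) \<in> curve_points f" using curve by (simp add: Affine_curve_point)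
  obtain X Y where lp: "local_parametrisation f (Affine x (- y)) (X, Y)"
      and sub: "Poly_Mapping.lookup E (Affine x (- y)) = fls_subdegree (poly_fls A X + poly_fls B X * Y)"
    using order_eq[OF c] by blast
  have "fls_subdegree (poly_fls A X) > 0"
    using affine_order_pos[OF lp, of A 0] \<open>poly A x = 0\<close> A by simp
  with sub \<open>B = 0\<close> have "Affine x (- y) = Affine x y \<or> Affine x (- y) = Affine x' (- y')"
    unfolding E by (auto split: if_splits)
  then show False using y ne by auto
qed

end

section \<open>Tangent lines of the caustic\<close>

text \<open>Here \<open>y0\<close> is the ordinate of a point over \<open>x = 0\<close>, of either
  sign; the factor \<open>sgn \<gamma>\<close> in the cubic is what makes it real.\<close>

locale poncelet_curve =
  fixes a b \<gamma> y0 :: real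
  assumes a: "a > 0" and b: "b > 0" and \<gamma>: "\<gamma> \<noteq> - b" "\<gamma> \<noteq> 0" "\<gamma> \<noteq> a"
    and y0: "y0\<^sup>2 = a * b * \<bar>\<gamma>\<bar>"
begin

text \<open>The light-like lines \<plusminus> X \<plusminus> Y = \<open>c\<close> are the common
  tangents of the confocal family.\<close>

definition c :: real where "c = sqrt (a + b)"

text \<open>
  The tangent lines \<open>\<xi> X + \<eta> Y = \<zeta>\<close> of the caustic satisfy \<open>(a - \<gamma>) \<xi>\<^sup>2 + (b + \<gamma>) \<eta>\<^sup>2 = \<zeta>\<^sup>2\<close>. Projecting
  this dual conic from the common tangent \<open>X + Y = c\<close> gives the parametrisation below, with that
  tangent at \<open>x = \<gamma>\<close> and \<open>X + Y + c = 0\<close> at \<open>x = \<infinity>\<close>. The sign of \<open>ordinate\<close> makes the fixed third point, of abscissa \<open>residual\<close>, collinear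
  with \<open>(0, y0)\<close> and \<open>(\<gamma>, 0)\<close>.
\<close>
definition xi :: "real \<Rightarrow> real" where "xi x = - x\<^sup>2 - 2 * b * x + a * b + \<gamma> * (a + b)"
definition eta :: "real \<Rightarrow> real" where "eta x = - x\<^sup>2 + 2 * a * x + a * b - \<gamma> * (a + b)"
definition zeta :: "real \<Rightarrow> real" where "zeta x = c * (x\<^sup>2 - 2 * \<gamma> * x + a * b + \<gamma> * (a - b))"

definition line_form :: "real \<Rightarrow> real \<times> real \<Rightarrow> real" where
  "line_form x p = xi x * fst p + eta x * snd p - zeta x"

text \<open>The form \<open>b * eta x * X - a * xi x * Y\<close> vanishes on the diameter of the
  ellipse that bisects the chord cut out by the line, so it takes opposite values at the two ends.
  The factor normalises its square to \<open>cubic x\<close>.\<close>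

definition ordinate :: "real \<Rightarrow> real \<times> real \<Rightarrow> real" where
  "ordinate x p = - y0 * (b * eta x * fst p - a * xi x * snd p) / (2 * a * b * c * \<gamma>)"

definition cubic :: "real \<Rightarrow> real" where
  "cubic x = sgn \<gamma> * ((a - x) * (b + x) * (\<gamma> - x))"

text \<open>The excluded values are the branch points, where the tangent of the caustic is
  light-like.\<close>

definition regular :: "real \<Rightarrow> bool" where "regular x \<longleftrightarrow> x \<noteq> a \<and> x \<noteq> - b \<and> x \<noteq> \<gamma>"

definition residual :: real where "residual = a - b + a * b / \<gamma>"

section \<open>Intersections of a tangent of the caustic with the ellipse\<close>

lemma c: "c\<^sup>2 = a + b" "c > 0"
  using a b by (simp_all add: c_def)

lemma y0_nonzero: "y0 \<noteq> 0"
  using y0 a b \<gamma> by auto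

lemma y0_sgn: "y0\<^sup>2 = a * b * \<gamma> * sgn \<gamma>"
  using y0 by (simp add: abs_sgn)

lemma caustic_eq: "(a - \<gamma>) * (xi x)\<^sup>2 + (b + \<gamma>) * (eta x)\<^sup>2 = (zeta x)\<^sup>2"
  unfolding xi_def eta_def zeta_def power_mult_distrib c by algebra

lemma xi_eta: "(xi x)\<^sup>2 - (eta x)\<^sup>2 = 4 * (a + b) * (x - a) * (x + b) * (x - \<gamma>)"
  unfolding xi_def eta_def by algebra

lemma xi_eta_regular: "regular x \<Longrightarrow> (xi x)\<^sup>2 \<noteq> (eta x)\<^sup>2"
  using xi_eta[of x] a b by (auto simp: regular_def)

lemma central_conic_iff: "p \<in> central_conic a b \<longleftrightarrow> b * (fst p)\<^sup>2 + a * (snd p)\<^sup>2 = a * b"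
  using a b by (cases p) (auto simp: central_conic_def field_simps)

text \<open>Lagrange's identity for the vectors (sqrt a \<xi>, sqrt b \<eta>) and (sqrt b X, sqrt a
  Y). The right-hand side vanishes exactly when the line touches the ellipse.\<close>

lemma conic_identity:
  fixes X Y \<xi> \<eta> \<zeta> :: real
  assumes "b * X\<^sup>2 + a * Y\<^sup>2 = a * b" "\<xi> * X + \<eta> * Y = \<zeta>"
  shows "(b * \<eta> * X - a * \<xi> * Y)\<^sup>2 = a * b * (a * \<xi>\<^sup>2 + b * \<eta>\<^sup>2 - \<zeta>\<^sup>2)"
proof -
  have "(b * \<eta> * X - a * \<xi> * Y)\<^sup>2 + a * b * (\<xi> * X + \<eta> * Y)\<^sup>2 = (a * \<xi>\<^sup>2 + b * \<eta>\<^sup>2) * (b * X\<^sup>2 + a * Y\<^sup>2)"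
    by algebra
  then show ?thesis unfolding assms by algebra
qed

text \<open>The two linear forms have determinant
  \<open>- (a * \<xi>\<^sup>2 + b * \<eta>\<^sup>2)\<close>, which is nonzero, so together they are
  coordinates of the plane.\<close>

lemma conic_point_eqI:
  fixes X Y \<xi> \<eta> :: real
  assumes "\<xi> * X + \<eta> * Y = \<xi> * X' + \<eta> * Y'"
    "b * \<eta> * X - a * \<xi> * Y = b * \<eta> * X' - a * \<xi> * Y'" "\<xi> \<noteq> 0 \<or> \<eta> \<noteq> 0"
  shows "X = X' \<and> Y = Y'"
proof -
  have pos: "a * \<xi>\<^sup>2 + b * \<eta>\<^sup>2 \<noteq> 0"
    using a b assms(3) by (simp add: add_nonneg_eq_0_iff)
  have "(a * \<xi>\<^sup>2 + b * \<eta>\<^sup>2) * (X - X') = 0" "(a * \<xi>\<^sup>2 + b * \<eta>\<^sup>2) * (Y - Y') = 0"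
    using assms(1,2) by algebra+
  with pos show ?thesis by simp
qed

lemma ordinate_square:
  assumes "p \<in> central_conic a b" "line_form x p = 0"
  shows "(ordinate x p)\<^sup>2 = cubic x"
proof -
  define s where "s = b * eta x * fst p - a * xi x * snd p"
  have "s\<^sup>2 = a * b * (a * (xi x)\<^sup>2 + b * (eta x)\<^sup>2 - (zeta x)\<^sup>2)"
    unfolding s_def using assms by (intro conic_identity) (auto simp: central_conic_iff line_form_def)
  \<comment> \<open>Confocality: subtracting the equation of the dual caustic leaves \<gamma> times
    the Minkowski square of the line coefficients, whose roots are the light-like tangents.\<close>
  also have "a * (xi x)\<^sup>2 + b * (eta x)\<^sup>2 - (zeta x)\<^sup>2 = \<gamma> * ((xi x)\<^sup>2 - (eta x)\<^sup>2)"
    using caustic_eq[of x] by algebra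
  finally have s: "s\<^sup>2 = 4 * a * b * \<gamma> * (a + b) * ((x - a) * (x + b) * (x - \<gamma>))"
    unfolding xi_eta by algebra
  have "(ordinate x p)\<^sup>2 = a * b * \<gamma> * sgn \<gamma> * s\<^sup>2 / (4 * (a * b * \<gamma>)\<^sup>2 * (a + b))"
    by (simp add: ordinate_def s_def power_mult_distrib power_divide y0_sgn c)
  also have "\<dots> = sgn \<gamma> * ((x - a) * (x + b) * (x - \<gamma>))"
    unfolding s using a b \<gamma> by (simp add: divide_simps power2_eq_square)
  also have "\<dots> = cubic x" by (simp add: cubic_def algebra_simps)
  finally show ?thesis .
qed

lemma ordinate_nonzero:
  assumes "p \<in> central_conic a b" "line_form x p = 0" "regular x"
  shows "ordinate x p \<noteq> 0"
proof -
  have "cubic x \<noteq> 0"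
    using assms(3) \<gamma> by (auto simp: cubic_def regular_def sgn_if)
  then show ?thesis using ordinate_square[OF assms(1,2)] by auto
qed

lemma ordinate_inj:
  assumes "line_form x p = 0" "line_form x p' = 0" "regular x" "ordinate x p = ordinate x p'"
  shows "p = p'"
proof -
  have "b * eta x * fst p - a * xi x * snd p = b * eta x * fst p' - a * xi x * snd p'"
    using assms(4) y0_nonzero a b c \<gamma> by (simp add: ordinate_def)
  moreover have "xi x * fst p + eta x * snd p = xi x * fst p' + eta x * snd p'"
    using assms(1,2) by (simp add: line_form_def)
  moreover have "xi x \<noteq> 0 \<or> eta x \<noteq> 0"
    using xi_eta_regular[OF assms(3)] by auto
  ultimately show ?thesis
    using conic_point_eqI by (metis prod_eq_iff)
qed

lemma ordinate_other_point:
  assumes "p \<in> central_conic a b" "p' \<in> central_conic a b" "line_form x p = 0" "line_form x p' = 0"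
    "regular x" "p \<noteq> p'"
  shows "ordinate x p' = - ordinate x p"
proof -
  have "(ordinate x p')\<^sup>2 = (ordinate x p)\<^sup>2" using ordinate_square assms by simp
  moreover have "ordinate x p' \<noteq> ordinate x p" using ordinate_inj[of x p p'] assms(3-6) by metis
  ultimately show ?thesis by (simp add: power2_eq_iff)
qed

text \<open>The parameter is found by inverting the projection of the dual conic from X + Y =
  \<open>c\<close>. A line through two points of the ellipse is not light-like, which keeps the
  parameter finite and regular.\<close>

lemma tangent_line_parameter:
  assumes tangent: "affine hull {p, p'} \<in> tangent_lines (a - \<gamma>) (b + \<gamma>)"
    and conic: "p \<in> central_conic a b" "p' \<in> central_conic a b" and ne: "p \<noteq> p'"
  obtains x where "regular x" "line_form x p = 0" "line_form x p' = 0"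
proof -
  obtain u v z where nz: "(u, v, z) \<noteq> (0, 0, 0)" and uvz: "u\<^sup>2 / (a - \<gamma>) + v\<^sup>2 / (b + \<gamma>) = z\<^sup>2"
    and hull: "affine hull {p, p'} = conic_tangent (a - \<gamma>) (b + \<gamma>) u v z"
    using tangent unfolding tangent_lines_def by blast
  have AB: "a - \<gamma> \<noteq> 0" "b + \<gamma> \<noteq> 0" using \<gamma> by auto
  \<comment> \<open>Passing from the point of contact to line coefficients treats asymptotes, where
    \<open>z = 0\<close>, like any other tangent.\<close>
  define \<xi> \<eta> where "\<xi> = u / (a - \<gamma>)" and "\<eta> = v / (b + \<gamma>)"
  have z2: "z\<^sup>2 = (a - \<gamma>) * \<xi>\<^sup>2 + (b + \<gamma>) * \<eta>\<^sup>2"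
    using uvz AB by (simp add: \<xi>_def \<eta>_def power2_eq_square)
  have on: "\<xi> * fst p + \<eta> * snd p = z" "\<xi> * fst p' + \<eta> * snd p' = z"
    using hull hull_subset[of "{p, p'}" affine]
    by (auto simp: conic_tangent_def \<xi>_def \<eta>_def split: prod.splits)
  have \<xi>\<eta>_nz: "\<xi> \<noteq> 0 \<or> \<eta> \<noteq> 0" using nz z2 AB by (auto simp: \<xi>_def \<eta>_def)
  \<comment> \<open>A light-like tangent of the caustic also touches the ellipse and would meet it
    in one point only, against \<open>p \<noteq> p'\<close>.\<close>
  have not_light: "\<xi>\<^sup>2 \<noteq> \<eta>\<^sup>2"
  proof
    assume eq: "\<xi>\<^sup>2 = \<eta>\<^sup>2"
    have "b * \<eta> * fst r - a * \<xi> * snd r = 0" if "r \<in> {p, p'}" for r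
    proof -
      have "(b * \<eta> * fst r - a * \<xi> * snd r)\<^sup>2 = a * b * (a * \<xi>\<^sup>2 + b * \<eta>\<^sup>2 - z\<^sup>2)"
        using that on conic by (intro conic_identity) (auto simp: central_conic_iff)
      also have "\<dots> = 0" unfolding z2 eq by algebra
      finally show ?thesis by simp
    qed
    then have s: "b * \<eta> * fst p - a * \<xi> * snd p = b * \<eta> * fst p' - a * \<xi> * snd p'" by simp
    have "fst p = fst p' \<and> snd p = snd p'"
      by (rule conic_point_eqI[OF _ s \<xi>\<eta>_nz]) (simp add: on)
    with ne show False by (simp add: prod_eq_iff)
  qed
  then have \<delta>: "\<xi> - \<eta> \<noteq> 0" by auto
  define x where "x = (a * \<xi> + b * \<eta> - c * z) / (\<xi> - \<eta>)"
  have x: "x * (\<xi> - \<eta>) = a * \<xi> + b * \<eta> - c * z" using \<delta> by (simp add: x_def)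
  \<comment> \<open>Factor of proportionality between the line coefficients given by the
    parametrisation at \<open>x\<close> and the original ones.\<close>
  define \<rho> where "\<rho> = - 2 * (a + b) * (x - \<gamma>)"
  have "(\<xi> - \<eta>) * ((\<xi> - \<eta>) * xi x - \<rho> * \<xi>) = 0" "(\<xi> - \<eta>) * ((\<xi> - \<eta>) * eta x - \<rho> * \<eta>) = 0"
    "(\<xi> - \<eta>) * ((\<xi> - \<eta>) * zeta x - \<rho> * z) = 0"
    using x z2 c(1) unfolding xi_def eta_def zeta_def \<rho>_def by algebra+
  then have scaled: "(\<xi> - \<eta>) * xi x = \<rho> * \<xi>" "(\<xi> - \<eta>) * eta x = \<rho> * \<eta>" "(\<xi> - \<eta>) * zeta x = \<rho> * z"
    using \<delta> by auto
  have "(\<xi> - \<eta>) * line_form x r = 0" if "\<xi> * fst r + \<eta> * snd r = z" for r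
  proof -
    have "(\<xi> - \<eta>) * line_form x r
        = (\<xi> - \<eta>) * xi x * fst r + (\<xi> - \<eta>) * eta x * snd r - (\<xi> - \<eta>) * zeta x"
      by (simp add: line_form_def algebra_simps)
    also have "\<dots> = \<rho> * (\<xi> * fst r + \<eta> * snd r - z)"
      unfolding scaled by (simp add: algebra_simps)
    finally show ?thesis using that by simp
  qed
  then have lines: "line_form x p = 0" "line_form x p' = 0" using on \<delta> by auto
  have "x \<noteq> a"
  proof
    assume "x = a"
    then have "c * z = (a + b) * \<eta>" using x by (simp add: algebra_simps)
    then have "(a + b) * ((a - \<gamma>) * (\<xi>\<^sup>2 - \<eta>\<^sup>2)) = 0" using z2 c(1) by algebra
    then show False using AB not_light a b by auto
  qed
  moreover have "x \<noteq> - b"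
  proof
    assume "x = - b"
    then have "c * z = (a + b) * \<xi>" using x by (simp add: algebra_simps)
    then have "(a + b) * ((b + \<gamma>) * (\<xi>\<^sup>2 - \<eta>\<^sup>2)) = 0" using z2 c(1) by algebra
    then show False using AB not_light a b by auto
  qed
  moreover have "x \<noteq> \<gamma>"
  proof
    assume "x = \<gamma>"
    then have "c * z = (a - \<gamma>) * \<xi> + (b + \<gamma>) * \<eta>" using x by (simp add: algebra_simps)
    then have "(a - \<gamma>) * (b + \<gamma>) * (\<xi> - \<eta>)\<^sup>2 = 0" using z2 c(1) by algebra
    then show False using AB \<delta> by auto
  qed
  ultimately show thesis using that lines by (auto simp: regular_def)
qed

section \<open>The two tangents of the caustic through a point of the ellipse\<close>

text \<open>For fixed \<open>p\<close> both \<open>ordinate x p\<close> and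
  \<open>line_form x p\<close> are quadratic in \<open>x\<close>. Reducing the first modulo the
  second gives a linear polynomial with the same values at \<open>x0\<close> and \<open>x1\<close>;
  this is the chord. Phrasing \<open>roots\<close> as a factorisation includes the case
  \<open>x0 = x1\<close>, where the chord is a tangent.\<close>

lemma chord_of_cubic:
  assumes p: "p \<in> central_conic a b" and W: "fst p + snd p + c \<noteq> 0"
    and roots: "\<And>x. line_form x p = - (fst p + snd p + c) * ((x - x0) * (x - x1))"
  shows "\<exists>m h. (\<forall>x. cubic x - (h + m * x)\<^sup>2 = sgn \<gamma> * ((x - x0) * (x - x1) * (x - residual))) \<and>
    h + m * residual = y0 * (\<gamma> - residual) / \<gamma> \<and>
    h + m * x0 = ordinate x0 p \<and> h + m * x1 = ordinate x1 p"
proof -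
  define X Y where "X = fst p" and "Y = snd p"
  define W M where "W = X + Y + c" and "M = b * X - a * Y"
  have W0: "W \<noteq> 0" using W by (simp add: W_def X_def Y_def)
  have E: "b * X\<^sup>2 + a * Y\<^sup>2 = a * b" using p by (simp add: central_conic_iff X_def Y_def)
  define s F where "s x = b * eta x * X - a * xi x * Y" and "F x = line_form x p" for x
  have F: "F x = xi x * X + eta x * Y - zeta x" for x
    by (simp add: F_def line_form_def X_def Y_def)
  define k where "k = - y0 / (2 * a * b * c * \<gamma>)"
  \<comment> \<open>Quotient of the leading coefficients of \<open>s\<close> and \<open>F\<close>,
    so that \<open>s x - \<mu> * F x\<close> is linear in \<open>x\<close>.\<close>
  define \<mu> where "\<mu> = M / W"
  define m where "m = k * (2 * a * b * (X + Y) - \<mu> * (2 * c * \<gamma> - 2 * M))"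
  define h where "h = k * (s 0 - \<mu> * F 0)"
  have \<mu>W: "\<mu> * W = M" using W0 by (simp add: \<mu>_def)
  have l: "h + m * x = k * (s x - \<mu> * F x)" for x
  proof -
    have "s x = - M * x\<^sup>2 + 2 * a * b * (X + Y) * x + s 0"
      unfolding s_def M_def xi_def eta_def by (simp add: algebra_simps power2_eq_square)
    moreover have "F x = - W * x\<^sup>2 + (2 * c * \<gamma> - 2 * M) * x + F 0"
      unfolding F M_def W_def xi_def eta_def zeta_def by (simp add: algebra_simps power2_eq_square)
    ultimately show ?thesis
      using \<mu>W unfolding h_def m_def by algebra
  qed
  have M2: "M\<^sup>2 = a * b * W * (2 * c - W)"
    using E c(1) unfolding M_def W_def by algebra
  have s2: "(s x)\<^sup>2 = 4 * a * b * \<gamma> * (a + b) * ((x - a) * (x + b) * (x - \<gamma>)) - a * b * (F x)\<^sup>2 - 2 * a * b * F x * zeta x" for x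
  proof -
    have "(s x)\<^sup>2 + a * b * (xi x * X + eta x * Y)\<^sup>2 = a * b * (a * (xi x)\<^sup>2 + b * (eta x)\<^sup>2)"
      unfolding s_def using E by algebra
    moreover have "xi x * X + eta x * Y = F x + zeta x" by (simp add: F)
    ultimately show ?thesis using caustic_eq[of x] xi_eta[of x] by algebra
  qed
  \<comment> \<open>This is \<open>W\<close> times the cofactor of \<open>F\<close> in the norm of
    the chord. On the ellipse it collapses to a linear polynomial independent of \<open>p\<close>,
    whose root is \<open>residual\<close>.\<close>
  have B: "2 * a * b * (X + Y) * F x + 2 * a * b * W * zeta x + 2 * s x * M
      = - 4 * (a + b) * a * b * (\<gamma> * x - \<gamma> * (a - b) - a * b)" for x
    using E c(1) unfolding F s_def M_def W_def xi_def eta_def zeta_def by algebra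
  have res: "\<gamma> * residual = \<gamma> * (a - b) + a * b"
    using \<gamma> by (simp add: residual_def algebra_simps)
  have roots': "F x = - W * ((x - x0) * (x - x1))" for x
    using roots by (simp add: F_def W_def X_def Y_def)
  have norm: "4 * a * b * \<gamma> * (a + b) * ((x - a) * (x + b) * (x - \<gamma>)) - (s x - \<mu> * F x)\<^sup>2
     = 4 * (a + b) * a * b * \<gamma> * ((x - x0) * (x - x1) * (x - residual))" for x
  proof -
    have "W * (a * b - \<mu>\<^sup>2) = 2 * a * b * (X + Y)"
    proof -
      have "W * (W * (a * b - \<mu>\<^sup>2)) = W * (2 * a * b * (X + Y))"
        using M2 \<mu>W unfolding W_def by algebra
      then show ?thesis using W0 by simp
    qed
    then have "W * ((a * b - \<mu>\<^sup>2) * F x + 2 * a * b * zeta x + 2 * \<mu> * s x)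
      = - 4 * (a + b) * a * b * (\<gamma> * x - \<gamma> * (a - b) - a * b)"
      using B[of x] \<mu>W by algebra
    moreover have "4 * a * b * \<gamma> * (a + b) * ((x - a) * (x + b) * (x - \<gamma>)) - (s x - \<mu> * F x)\<^sup>2
      = F x * ((a * b - \<mu>\<^sup>2) * F x + 2 * a * b * zeta x + 2 * \<mu> * s x)"
      using s2[of x] by algebra
    ultimately have "4 * a * b * \<gamma> * (a + b) * ((x - a) * (x + b) * (x - \<gamma>)) - (s x - \<mu> * F x)\<^sup>2
      = ((x - x0) * (x - x1)) * (4 * (a + b) * a * b * (\<gamma> * x - \<gamma> * (a - b) - a * b))"
      using roots'[of x] by algebra
    then show ?thesis using res by algebra
  qed
  have k2: "k\<^sup>2 * (4 * a * b * \<gamma> * (a + b)) = sgn \<gamma>"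
    using a b \<gamma> by (simp add: k_def power_divide power_mult_distrib y0_sgn c) (simp add: divide_simps power2_eq_square)
  have "cubic x - (h + m * x)\<^sup>2 = sgn \<gamma> * ((x - x0) * (x - x1) * (x - residual))" for x
    using norm[of x] k2 unfolding l cubic_def by algebra
  moreover have "h + m * residual = y0 * (\<gamma> - residual) / \<gamma>"
  proof -
    \<comment> \<open>The ordinate of the third intersection is independent of \<open>p\<close> too,
      so all these chords pass through one fixed point.\<close>
    have "\<gamma> * (W * s residual - M * F residual - 2 * a * b * c * W * (residual - \<gamma>)) = 0"
      using E c(1) res unfolding F s_def M_def W_def xi_def eta_def zeta_def by algebra
    then have "W * (s residual - \<mu> * F residual) = W * (2 * a * b * c * (residual - \<gamma>))"
      using \<gamma> \<mu>W by simp algebra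
    then show ?thesis
      using W0 a b c(2) \<gamma> unfolding l k_def by (simp add: divide_simps) (simp add: algebra_simps)
  qed
  moreover have "h + m * x0 = ordinate x0 p" "h + m * x1 = ordinate x1 p"
    unfolding l roots' by (simp_all add: ordinate_def k_def s_def X_def Y_def)
  ultimately show ?thesis by blast
qed

text \<open>As a polynomial in \<open>x\<close>, \<open>line_form x p\<close> has degree at most 2
  and \<open>x\<^sup>2\<close>-coefficient \<open>- (fst p + snd p + c)\<close>; two distinct roots
  then determine it.\<close>

lemma line_form_roots:
  assumes "line_form x0 p = 0" "line_form x1 p = 0" "x0 \<noteq> x1"
  shows "line_form x p = - (fst p + snd p + c) * ((x - x0) * (x - x1))"
proof -
  have "(x0 - x1) * (line_form x p + (fst p + snd p + c) * ((x - x0) * (x - x1))) = 0"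
    using assms(1,2) unfolding line_form_def xi_def eta_def zeta_def by algebra
  with assms(3) have "line_form x p + (fst p + snd p + c) * ((x - x0) * (x - x1)) = 0" by simp
  then show ?thesis by algebra
qed

text \<open>
  A trajectory that meets the ellipse orthogonally at \<open>p\<close> runs back along the same line; then \<open>p\<close>
  lies on the caustic, since confocal conics are orthogonal.
\<close>
lemma line_form_double_root:
  assumes p: "p \<in> central_conic a b" and on: "line_form x0 p = 0" and reg: "regular x0"
    and normal: "a * eta x0 * snd p = b * xi x0 * fst p"
  shows "line_form x p = - (fst p + snd p + c) * ((x - x0) * (x - x0))"
proof -
  define X Y \<xi> \<eta> \<zeta> where defs: "X = fst p" "Y = snd p" "\<xi> = xi x0" "\<eta> = eta x0" "\<zeta> = zeta x0"
  have E: "b * X\<^sup>2 + a * Y\<^sup>2 = a * b" using p by (simp add: central_conic_iff defs)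
  have line: "\<xi> * X + \<eta> * Y = \<zeta>" using on by (simp add: line_form_def defs)
  have n: "a * \<eta> * Y = b * \<xi> * X" using normal by (simp add: defs)
  have ca: "(a - \<gamma>) * \<xi>\<^sup>2 + (b + \<gamma>) * \<eta>\<^sup>2 = \<zeta>\<^sup>2" unfolding defs by (rule caustic_eq)
  have nl: "\<xi>\<^sup>2 \<noteq> \<eta>\<^sup>2" unfolding defs by (rule xi_eta_regular[OF reg])
  have X: "(a + b) * \<xi> * X = a * \<zeta>" and Y: "(a + b) * \<eta> * Y = b * \<zeta>"
  proof -
    have "a * (\<xi> * X + \<eta> * Y) = a * \<zeta>" "b * (\<xi> * X + \<eta> * Y) = b * \<zeta>" using line by simp_all
    then show "(a + b) * \<xi> * X = a * \<zeta>" "(a + b) * \<eta> * Y = b * \<zeta>"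
      using n by (simp_all add: algebra_simps)
  qed
  have "a * b * \<zeta>\<^sup>2 * (a * \<eta>\<^sup>2 + b * \<xi>\<^sup>2) = a * b * (a + b)\<^sup>2 * \<xi>\<^sup>2 * \<eta>\<^sup>2"
    using X Y E by algebra
  then have "\<zeta>\<^sup>2 * (a * \<eta>\<^sup>2 + b * \<xi>\<^sup>2) = (a + b)\<^sup>2 * \<xi>\<^sup>2 * \<eta>\<^sup>2"
    using a b by simp
  then have "(\<xi>\<^sup>2 - \<eta>\<^sup>2) * (b * (a - \<gamma>) * \<xi>\<^sup>2 - a * (b + \<gamma>) * \<eta>\<^sup>2) = 0"
    using ca by algebra
  then have K: "b * (a - \<gamma>) * \<xi>\<^sup>2 = a * (b + \<gamma>) * \<eta>\<^sup>2" using nl by simp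
  have ne: "\<xi> \<noteq> 0" "\<eta> \<noteq> 0" using K nl a b \<gamma> by auto
  have "\<zeta> \<noteq> 0"
  proof
    assume "\<zeta> = 0"
    then have "X = 0" "Y = 0" using X Y ne a b by auto
    then show False using E a b by simp
  qed
  have "\<xi> * (a + b) * (X * \<zeta> - (a - \<gamma>) * \<xi>) = 0" "\<eta> * (a + b) * (Y * \<zeta> - (b + \<gamma>) * \<eta>) = 0"
    using X Y ca K by algebra+
  \<comment> \<open>These are the polar relations saying that \<open>p\<close> is the point where
    the line touches the caustic.\<close>
  then have contact: "X * \<zeta> = (a - \<gamma>) * \<xi>" "Y * \<zeta> = (b + \<gamma>) * \<eta>" using ne a b by auto
  \<comment> \<open>Minus half the derivative of \<open>line_form\<close> in the parameter at
    \<open>x0\<close>. It vanishes because the caustic is the envelope of its tangents and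
    \<open>p\<close> is the point of contact.\<close>
  define d where "d = (x0 + b) * X + (x0 - a) * Y + c * (x0 - \<gamma>)"
  have "\<zeta> * d = 0"
  proof -
    have "\<zeta> * d = (x0 + b) * ((a - \<gamma>) * \<xi>) + (x0 - a) * ((b + \<gamma>) * \<eta>) + c * (x0 - \<gamma>) * \<zeta>"
      using contact unfolding d_def by algebra
    also have "\<dots> = 0"
      unfolding defs xi_def eta_def zeta_def using c(1) by algebra
    finally show ?thesis .
  qed
  with \<open>\<zeta> \<noteq> 0\<close> have "d = 0" by simp
  moreover have "line_form x p = line_form x0 p - 2 * (x - x0) * d - (fst p + snd p + c) * ((x - x0) * (x - x0))"
    unfolding d_def defs line_form_def xi_def eta_def zeta_def by algebra
  ultimately show ?thesis using on by algebra
qed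

section \<open>The reflection law\<close>

lemma tangent_direction:
  assumes "p \<in> central_conic a b"
  shows "(a * snd p, - b * fst p) \<in> line_directions (conic_tangent a b (fst p) (snd p) 1)"
  unfolding line_directions_def
proof (intro CollectI exI conjI)
  show "(a * snd p, - b * fst p) = (fst p + a * snd p, snd p - b * fst p) - p"
    by (simp add: prod_eq_iff)
  have "fst p * fst p / a + snd p * snd p / b = 1"
    using assms a b by (simp add: central_conic_iff field_simps power2_eq_square)
  moreover have "fst p * (fst p + a * snd p) / a + snd p * (snd p - b * fst p) / b
      = fst p * fst p / a + snd p * snd p / b"
    using a b by (simp add: distrib_left right_diff_distrib add_divide_distrib diff_divide_distrib)
  ultimately show "p \<in> conic_tangent a b (fst p) (snd p) 1"
    "(fst p + a * snd p, snd p - b * fst p) \<in> conic_tangent a b (fst p) (snd p) 1"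
    by (auto simp: conic_tangent_def split: prod.splits)
qed

text \<open>If the sum were zero, \<open>p\<close> would lie on a common tangent of the confocal
  family. That line touches the ellipse at \<open>p\<close>, so the tangent there would be
  light-like.\<close>

lemma tangent_not_light:
  assumes p: "p \<in> central_conic a b"
    and nl: "\<And>d. d \<in> line_directions (conic_tangent a b (fst p) (snd p) 1) \<Longrightarrow> d \<noteq> 0 \<Longrightarrow> \<not> light_like d"
  shows "fst p + snd p + c \<noteq> 0"
proof
  assume W: "fst p + snd p + c = 0"
  have E: "b * (fst p)\<^sup>2 + a * (snd p)\<^sup>2 = a * b" using p by (simp add: central_conic_iff)
  have "(b * fst p - a * snd p)\<^sup>2 = 0" using E W c(1) by algebra
  then have eq: "b * fst p = a * snd p" by simp
  have "(a * snd p, - b * fst p) \<noteq> 0"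
  proof
    assume "(a * snd p, - b * fst p) = 0"
    then have "fst p = 0" "snd p = 0" using a b by (auto simp: zero_prod_def)
    then show False using E a b by simp
  qed
  moreover have "light_like (a * snd p, - b * fst p)"
    using eq by (simp add: light_like_def minkowski_def)
  ultimately show False using nl tangent_direction[OF p] by blast
qed

text \<open>Distinct parameters are the two roots of the quadratic \<open>line_form x p\<close>.
  Equal parameters mean that the trajectory runs back to \<open>A\<close>; by the reflection law it
  then meets the ellipse orthogonally, which gives a double root.\<close>

lemma reflection_line_form:
  assumes conic: "A \<in> central_conic a b" "p \<in> central_conic a b" "B \<in> central_conic a b"
    and ne: "A \<noteq> p" "p \<noteq> B"
    and refl: "billiard_reflection (conic_tangent a b (fst p) (snd p) 1) (p - A) v'" "r > 0" "B - p = r *\<^sub>R v'"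
    and x0: "regular x0" "line_form x0 A = 0" "line_form x0 p = 0"
    and x1: "regular x1" "line_form x1 p = 0" "line_form x1 B = 0"
  shows "fst p + snd p + c \<noteq> 0 \<and> (\<forall>x. line_form x p = - (fst p + snd p + c) * ((x - x0) * (x - x1)))"
proof
  define T where "T = line_directions (conic_tangent a b (fst p) (snd p) 1)"
  have nl: "\<And>d. d \<in> T \<Longrightarrow> d \<noteq> 0 \<Longrightarrow> \<not> light_like d"
    using refl(1) unfolding billiard_reflection_def T_def by blast
  then show "fst p + snd p + c \<noteq> 0" using tangent_not_light[OF conic(2)] unfolding T_def by blast
  show "\<forall>x. line_form x p = - (fst p + snd p + c) * ((x - x0) * (x - x1))"
  proof (cases "x0 = x1")
    case False
    then show ?thesis using line_form_roots x0 x1 by blast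
  next
    case True
    then have "ordinate x0 A = ordinate x0 B"
      using ordinate_other_point[of p A x0] ordinate_other_point[of p B x0] conic ne x0 x1 by auto
    then have "A = B" using ordinate_inj x0 x1 True by blast
    obtain u w where uw: "p - A = u + w" "u \<in> T" "\<And>d. d \<in> T \<Longrightarrow> minkowski w d = 0" "v' = u - w"
      using refl(1) unfolding billiard_reflection_def T_def by blast
    have "- (u + w) = r *\<^sub>R (u - w)"
      using refl(3) uw(1,4) \<open>A = B\<close> by (metis minus_diff_eq)
    then have eq: "(1 + r) * fst u = (r - 1) * fst w" "(1 + r) * snd u = (r - 1) * snd w"
      by (auto simp: prod_eq_iff algebra_simps)
    \<comment> \<open>Pairing the reversed direction with its tangential part \<open>u\<close> makes
      \<open>u\<close> light-like, as \<open>1 + r > 0\<close>. The tangent is not light-like, so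
      \<open>u\<close> is zero.\<close>
    have "(1 + r) * minkowski u u = (r - 1) * minkowski w u"
      using eq unfolding minkowski_def by algebra
    also have "\<dots> = 0" using uw by simp
    finally have "light_like u" using refl(2) by (simp add: light_like_def)
    then have "u = 0" using nl uw(2) by blast
    then have "minkowski (p - A) (a * snd p, - b * fst p) = 0"
      using uw tangent_direction[OF conic(2)] by (simp add: T_def)
    then have perp: "(fst p - fst A) * (a * snd p) + (snd p - snd A) * (b * fst p) = 0"
      by (simp add: minkowski_def)
    have along: "xi x0 * (fst p - fst A) + eta x0 * (snd p - snd A) = 0"
      using x0 unfolding line_form_def by (simp add: algebra_simps)
    have "(fst p - fst A) * (a * eta x0 * snd p - b * xi x0 * fst p) = 0"
      "(snd p - snd A) * (a * eta x0 * snd p - b * xi x0 * fst p) = 0"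
      using perp along by algebra+
    moreover have "fst p - fst A \<noteq> 0 \<or> snd p - snd A \<noteq> 0" using ne by (auto simp: prod_eq_iff)
    ultimately have "a * eta x0 * snd p = b * xi x0 * fst p" by auto
    then show ?thesis using line_form_double_root[OF conic(2) x0(3,1)] True by blast
  qed
qed

end

section \<open>The theorem\<close>

lemma map_poly_of_real_mult:
  "map_poly complex_of_real (p * q) = map_poly complex_of_real p * map_poly complex_of_real q"
  by (intro poly_eqI) (simp add: coeff_map_poly coeff_mult)

lemma map_poly_of_real_diff:
  "map_poly complex_of_real (p - q) = map_poly complex_of_real p - map_poly complex_of_real q"
  by (intro poly_eqI) (simp add: coeff_map_poly)

lemma billiard_cubic_simple:
  assumes "a > 0" "b > 0" "\<gamma> \<noteq> - b" "\<gamma> \<noteq> 0" "\<gamma> \<noteq> a"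
  shows "simple_cubic (billiard_cubic a b \<gamma>)"
proof
  have "complex_of_real (sgn \<gamma>) \<noteq> 0" using assms by (simp add: sgn_if)
  then show "degree (billiard_cubic a b \<gamma>) = 3"
    by (simp add: billiard_cubic_def)
next
  fix x
  define s u v w where "s = complex_of_real (sgn \<gamma>)" and "u = complex_of_real a"
    and "v = complex_of_real b" and "w = complex_of_real \<gamma>"
  have s: "s \<noteq> 0" using assms by (simp add: s_def sgn_if)
  have d: "u + v \<noteq> 0" "u \<noteq> w" "v + w \<noteq> 0"
    using assms by (auto simp: u_def v_def w_def simp flip: of_real_add)
  have cubic: "billiard_cubic a b \<gamma> = smult s ([:u, -1:] * [:v, 1:] * [:w, -1:])"
    by (simp only: billiard_cubic_def s_def u_def v_def w_def)
  assume "poly (billiard_cubic a b \<gamma>) x = 0"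
  then have "s * ((u - x) * (v + x) * (w - x)) = 0"
    unfolding cubic poly_smult poly_mult by simp
  then have "x = u \<or> x = - v \<or> x = w"
    using s by (auto simp: add_eq_0_iff)
  moreover have "poly (pderiv (billiard_cubic a b \<gamma>)) x
      = s * (- ((v + x) * (w - x)) + (u - x) * (w - x) - (u - x) * (v + x))"
    unfolding cubic pderiv_smult pderiv_mult by (simp add: pderiv_pCons algebra_simps)
  ultimately show "poly (pderiv (billiard_cubic a b \<gamma>)) x \<noteq> 0"
    using s d by (auto simp: add.commute add_eq_0_iff)
qed

context poncelet_curve
begin

abbreviation curve :: "complex poly" where "curve \<equiv> billiard_cubic a b \<gamma>"

sublocale simple_cubic curve
  using billiard_cubic_simple a b \<gamma> by blast

definition real_point :: "real \<Rightarrow> real \<Rightarrow> curve_point" where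
  "real_point x y = Affine (of_real x) (of_real y)"

lemma poly_curve: "poly curve (of_real x) = of_real (cubic x)"
  by (simp add: billiard_cubic_def cubic_def algebra_simps)

text \<open>An identity at all real \<open>x\<close> is an identity of real polynomials, and its
  coefficients can then be mapped into the complex numbers.\<close>

lemma principal_divisor_real_line:
  assumes "\<And>x. cubic x - (h + m * x)\<^sup>2 = sgn \<gamma> * ((x - x1) * (x - x2) * (x - x3))"
  shows "principal_divisor curve
    (frag_of (real_point x1 (h + m * x1)) + frag_of (real_point x2 (h + m * x2)) + frag_of (real_point x3 (h + m * x3))
      - frag_cmul 3 (frag_of Infinity))"
proof -
  have "poly (smult (sgn \<gamma>) ([:a, -1:] * [:b, 1:] * [:\<gamma>, -1:]) - [:h, m:] * [:h, m:]) x
    = poly (smult (sgn \<gamma>) ([:- x1, 1:] * [:- x2, 1:] * [:- x3, 1:])) x" for x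
    unfolding poly_diff poly_smult poly_mult
    using assms[of x] by (simp add: cubic_def power2_eq_square algebra_simps)
  then have "smult (sgn \<gamma>) ([:a, -1:] * [:b, 1:] * [:\<gamma>, -1:]) - [:h, m:] * [:h, m:]
    = smult (sgn \<gamma>) ([:- x1, 1:] * [:- x2, 1:] * [:- x3, 1:])"
    by (intro poly_eq_poly_eq_iff[THEN iffD1] ext)
  from arg_cong[OF this, of "map_poly complex_of_real"]
  have "curve - [:of_real h, of_real m:]\<^sup>2
    = smult (of_real (sgn \<gamma>)) ([:- of_real x1, 1:] * [:- of_real x2, 1:] * [:- of_real x3, 1:])"
    unfolding billiard_cubic_def power2_eq_square map_poly_of_real_diff map_poly_smult[of complex_of_real, simplified]
      map_poly_of_real_mult
    by (simp add: map_poly_pCons del: mult_pCons_left mult_pCons_right)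
  moreover have "complex_of_real (sgn \<gamma>) \<noteq> 0" using \<gamma> by (simp add: sgn_if)
  ultimately show ?thesis
    using principal_divisor_line[of "of_real h" "of_real m" "of_real (sgn \<gamma>)" "of_real x1" "of_real x2" "of_real x3"]
    by (simp add: real_point_def mult.commute)
qed

text \<open>The line through (0, \<open>y0\<close>) and (\<gamma>, 0) meets the curve again over
  \<open>residual\<close>, at the point shared by all chords.\<close>

lemma base_line:
  "cubic x - (y0 + - (y0 / \<gamma>) * x)\<^sup>2 = sgn \<gamma> * ((x - 0) * (x - \<gamma>) * (x - residual))"
proof -
  define t where "t = a * b / \<gamma>"
  have t: "a * b = t * \<gamma>" using \<gamma> by (simp add: t_def)
  have "(y0 + - (y0 / \<gamma>) * x)\<^sup>2 = y0\<^sup>2 / \<gamma>\<^sup>2 * (x - \<gamma>)\<^sup>2"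
    using \<gamma> by (simp add: field_simps power2_eq_square)
  also have "y0\<^sup>2 / \<gamma>\<^sup>2 = sgn \<gamma> * t"
    unfolding y0_sgn t_def using \<gamma> by (simp add: power2_eq_square)
  finally show ?thesis
    unfolding cubic_def residual_def t_def[symmetric] using t by algebra
qed

definition Q_zero :: curve_point where "Q_zero = real_point 0 y0"
definition Q_gamma :: curve_point where "Q_gamma = real_point \<gamma> 0"

lemma poncelet_step:
  assumes conic: "A \<in> central_conic a b" "p \<in> central_conic a b" "B \<in> central_conic a b"
    and ne: "A \<noteq> p" "p \<noteq> B"
    and refl: "billiard_reflection (conic_tangent a b (fst p) (snd p) 1) (p - A) v'" "r > 0" "B - p = r *\<^sub>R v'"
    and x0: "regular x0" "line_form x0 A = 0" "line_form x0 p = 0"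
    and x1: "regular x1" "line_form x1 p = 0" "line_form x1 B = 0"
  shows "principal_divisor curve (frag_of (real_point x0 (ordinate x0 p)) - frag_of (real_point x1 (ordinate x1 B))
    - (frag_of Q_zero - frag_of Q_gamma))"
proof -
  obtain m h where mh: "\<And>x. cubic x - (h + m * x)\<^sup>2 = sgn \<gamma> * ((x - x0) * (x - x1) * (x - residual))"
    and res: "h + m * residual = y0 * (\<gamma> - residual) / \<gamma>"
    and ord: "h + m * x0 = ordinate x0 p" "h + m * x1 = ordinate x1 p"
    using chord_of_cubic[OF conic(2)] reflection_line_form[OF assms] by metis
  define R where "R = real_point residual (y0 * (\<gamma> - residual) / \<gamma>)"
  have chord: "principal_divisor curve (frag_of (real_point x0 (ordinate x0 p)) + frag_of (real_point x1 (ordinate x1 p))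
      + frag_of R - frag_cmul 3 (frag_of Infinity))"
    using principal_divisor_real_line[OF mh] by (simp add: ord res R_def)
  have "y0 + - (y0 / \<gamma>) * residual = y0 * (\<gamma> - residual) / \<gamma>" "y0 + - (y0 / \<gamma>) * \<gamma> = 0"
    using \<gamma> by (simp_all add: field_simps)
  then have base: "principal_divisor curve (frag_of Q_zero + frag_of Q_gamma + frag_of R - frag_cmul 3 (frag_of Infinity))"
    using principal_divisor_real_line[OF base_line] by (simp add: R_def Q_zero_def Q_gamma_def)
  have "(ordinate x1 B)\<^sup>2 = cubic x1" using ordinate_square conic x1 by blast
  then have "principal_divisor curve (frag_of (real_point x1 (ordinate x1 B))
      + frag_of (real_point x1 (- ordinate x1 B)) - frag_cmul 2 (frag_of Infinity))"
    using principal_divisor_vertical_line[of "of_real (ordinate x1 B)" "of_real x1"]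
    by (simp add: poly_curve real_point_def flip: of_real_power)
  moreover have "- ordinate x1 B = ordinate x1 p"
    using ordinate_other_point[OF conic(2,3) x1(2,3,1) ne(2)] by simp
  ultimately have vert: "principal_divisor curve (frag_of (real_point x1 (ordinate x1 B))
      + frag_of (real_point x1 (ordinate x1 p)) - frag_cmul 2 (frag_of Infinity))"
    by simp
  have "cubic \<gamma> = 0" by (simp add: cubic_def)
  then have branch: "principal_divisor curve (frag_of Q_gamma + frag_of Q_gamma - frag_cmul 2 (frag_of Infinity))"
    using principal_divisor_vertical_line[of 0 "of_real \<gamma>"]
    by (simp add: poly_curve real_point_def Q_gamma_def)
  \<comment> \<open>The chord minus the base line cancels the fixed third point, the vertical line
    at \<open>x1\<close> replaces the end \<open>p\<close> of the second segment by
    \<open>B\<close>, and twice \<open>Q_gamma\<close> is equivalent to twice infinity.\<close>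
  from principal_divisor_add[OF principal_divisor_diff[OF principal_divisor_diff[OF chord base] vert] branch]
  show ?thesis by (simp add: algebra_simps)
qed

end

theorem theorem3p1:
  fixes a b \<gamma> :: real and n :: nat and P :: "nat \<Rightarrow> real \<times> real" and Q0 :: curve_point and y0 :: complex
  assumes "a > 0" and "b > 0"
    and "\<gamma> \<noteq> - b" and "\<gamma> \<noteq> 0" and "\<gamma> \<noteq> a"
    and "n > 0"
    and "billiard_trajectory a b P"
    and "has_caustic a b \<gamma> P"
    and "Q0 = Affine 0 y0" and "Q0 \<in> curve_points (billiard_cubic a b \<gamma>)"
  shows "periodic_trajectory n P \<longleftrightarrow>
    linearly_equivalent (billiard_cubic a b \<gamma>)
      (frag_cmul (int n) (frag_of Q0))
      (frag_cmul (int n) (frag_of (Affine (of_real \<gamma>) 0)))"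
proof -
  have "y0\<^sup>2 = of_real (sgn \<gamma> * (a * b * \<gamma>))"
    using assms(9,10) by (simp add: curve_points_def billiard_cubic_def algebra_simps)
  also have "sgn \<gamma> * (a * b * \<gamma>) = a * b * \<bar>\<gamma>\<bar>" by (simp add: abs_sgn)
  also have "\<dots> = (sqrt (a * b * \<bar>\<gamma>\<bar>))\<^sup>2" using assms by simp
  \<comment> \<open>The ordinate of \<open>Q0\<close> is real, with either sign, so the real
    construction applies whichever point over 0 is chosen.\<close>
  finally have "y0 = of_real (sqrt (a * b * \<bar>\<gamma>\<bar>)) \<or> y0 = of_real (- sqrt (a * b * \<bar>\<gamma>\<bar>))"
    unfolding of_real_power power2_eq_iff by simp
  then obtain r where r: "y0 = of_real r" "r\<^sup>2 = a * b * \<bar>\<gamma>\<bar>"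
    using assms(1,2) by auto
  interpret poncelet_curve a b \<gamma> r
    using assms r by unfold_locales auto
  have conic: "P i \<in> central_conic a b" and ne: "P i \<noteq> P (Suc i)" for i
    using assms(7) by (simp_all add: billiard_trajectory_def)
  have refl: "\<exists>v' r. billiard_reflection (conic_tangent a b (fst (P (Suc i))) (snd (P (Suc i))) 1) (P (Suc i) - P i) v' \<and>
      r > 0 \<and> P (Suc (Suc i)) - P (Suc i) = r *\<^sub>R v'" for i
    using assms(7) by (simp add: billiard_trajectory_def)
  \<comment> \<open>The parameter is chosen as a function of the two end points, so equal segments
    receive equal parameters.\<close>
  define param where "param p p' = (SOME x. regular x \<and> line_form x p = 0 \<and> line_form x p' = 0)" for p p'
  define x where "x i = param (P i) (P (Suc i))" for i
  have x: "regular (x i)" "line_form (x i) (P i) = 0" "line_form (x i) (P (Suc i)) = 0" for i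
  proof -
    have "\<exists>x. regular x \<and> line_form x (P i) = 0 \<and> line_form x (P (Suc i)) = 0"
      using tangent_line_parameter[OF _ conic conic ne] assms(8) unfolding has_caustic_def Suc_eq_plus1 by metis
    from someI_ex[OF this]
    show "regular (x i)" "line_form (x i) (P i) = 0" "line_form (x i) (P (Suc i)) = 0"
      unfolding x_def param_def by blast+
  qed
  define S where "S i = real_point (x i) (ordinate (x i) (P (Suc i)))" for i
  define \<tau> where "\<tau> = frag_of Q_zero - frag_of Q_gamma"
  have step: "principal_divisor curve (frag_of (S i) - frag_of (S (Suc i)) - \<tau>)" for i
    using poncelet_step[OF conic conic conic ne ne _ _ _ x x] refl unfolding S_def \<tau>_def by metis
  have steps: "principal_divisor curve (frag_of (S i) - frag_of (S (i + k)) - frag_cmul (int k) \<tau>)" for i k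
  proof (induction k)
    case (Suc k)
    have "frag_of (S i) - frag_of (S (i + Suc k)) - frag_cmul (int (Suc k)) \<tau>
      = (frag_of (S i) - frag_of (S (i + k)) - frag_cmul (int k) \<tau>) + (frag_of (S (i + k)) - frag_of (S (Suc (i + k))) - \<tau>)"
      by (simp add: frag_cmul_distrib algebra_simps)
    then show ?case using principal_divisor_add[OF Suc step] by metis
  qed (simp add: principal_divisor_0)
  have scale_diff: "frag_cmul k (D - E) = frag_cmul k D - frag_cmul k E" for k and D E :: "curve_point \<Rightarrow>\<^sub>0 int"
    by (simp add: right_diff_distrib lookup_minus poly_mapping_eqI)
  have equiv: "linearly_equivalent curve (frag_cmul (int n) (frag_of Q0)) (frag_cmul (int n) (frag_of (Affine (of_real \<gamma>) 0)))
      \<longleftrightarrow> principal_divisor curve (frag_cmul (int n) \<tau>)"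
    by (simp add: linearly_equivalent_def \<tau>_def scale_diff Q_zero_def Q_gamma_def real_point_def assms(9) r(1))
  show ?thesis
  proof
    assume "periodic_trajectory n P"
    then have "P n = P 0" "P (Suc n) = P (Suc 0)"
      unfolding periodic_trajectory_def by (metis add_0 add_Suc)+
    then have "S n = S 0" by (simp add: S_def x_def)
    then show "linearly_equivalent curve (frag_cmul (int n) (frag_of Q0)) (frag_cmul (int n) (frag_of (Affine (of_real \<gamma>) 0)))"
      using principal_divisor_uminus[OF steps[of 0 n]] by (simp add: equiv)
  next
    assume "linearly_equivalent curve (frag_cmul (int n) (frag_of Q0)) (frag_cmul (int n) (frag_of (Affine (of_real \<gamma>) 0)))"
    then have n\<tau>: "principal_divisor curve (frag_cmul (int n) \<tau>)" by (simp add: equiv)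
    have "P (i + n) = P i" for i
    proof -
      have diff: "principal_divisor curve (frag_of (S i) - frag_of (S (i + n)))"
        using principal_divisor_add[OF steps[of i n] n\<tau>] by simp
      have curve: "(complex_of_real (ordinate (x j) (P (Suc j))))\<^sup>2 = poly curve (of_real (x j))" for j
        using ordinate_square[OF conic x(3)] by (simp add: poly_curve flip: of_real_power)
      have "S i = S (i + n)"
        unfolding S_def real_point_def
      proof (rule principal_difference_of_points[OF _ curve curve])
        show "complex_of_real (ordinate (x i) (P (Suc i))) \<noteq> 0"
          using ordinate_nonzero[OF conic x(3,1)] by simp
      qed (use diff in \<open>simp add: S_def real_point_def\<close>)
      then have xx: "x (i + n) = x i"
        and oo: "ordinate (x i) (P (Suc i)) = ordinate (x i) (P (Suc (i + n)))"
        by (auto simp: S_def real_point_def)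
      \<comment> \<open>Equality of the points \<open>S\<close> compares the far ends of two
        segments. Changing both signs compares the near ends \<open>P i\<close> and
        \<open>P (i + n)\<close> on the same line, where the ordinate is injective.\<close>
      have "ordinate (x j) (P (Suc j)) = - ordinate (x j) (P j)" for j
        by (rule ordinate_other_point[OF conic conic x(2,3,1) ne])
      from this[of i] this[of "i + n"] have "ordinate (x i) (P (i + n)) = ordinate (x i) (P i)"
        using xx oo by simp
      then show ?thesis
        using ordinate_inj x(1,2)[of i] x(2)[of "i + n"] xx by metis
    qed
    then show "periodic_trajectory n P" by (simp add: periodic_trajectory_def)
  qed
qed

end
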